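(* Let $v$ be a convex function on $B_1\subset\mathbb{R}^n$. Let $\Sigma_v$ be the set of points $x\in B_1$ such that for every subgradient $p$ of $v$ at $x$ there exist $C_{x,p}>0$ and $h_0>0$ with $$|S^v_{h,p}(x)|<C_{x,p}\,h^{\frac{n+1}{2}}\quad\text{for all }0<h<h_0.$$ Then $\mathcal{H}^{n-1}(\Sigma_v)=0$.
   Context: $p$ is a subgradient of $v$ at $x$ if $v(y)\ge v(x)+p\cdot(y-x)$ for all $y\in B_1$. The section is $S^v_{h,p}(x)=\{y\in B_1: v(y)<v(x)+p\cdot(y-x)+h\}$, and $|\cdot|$ denotes Lebesgue measure. *)

theory Defs
  imports "HOL-Analysis.Analysis"
begin

abbreviation B1 :: "'a::euclidean_space set" where
  "B1 \<equiv> ball 0 1"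

definition subgradient_at :: "('a::euclidean_space \<Rightarrow> real) \<Rightarrow> 'a \<Rightarrow> 'a \<Rightarrow> bool" where
  "subgradient_at v x p \<longleftrightarrow> (\<forall>y\<in>B1. v y \<ge> v x + inner p (y - x))"

definition section_set :: "('a::euclidean_space \<Rightarrow> real) \<Rightarrow> real \<Rightarrow> 'a \<Rightarrow> 'a \<Rightarrow> 'a set" where
  "section_set v h p x = {y\<in>B1. v y < v x + inner p (y - x) + h}"

definition Sigma_v :: "('a::euclidean_space \<Rightarrow> real) \<Rightarrow> 'a set" where
  "Sigma_v v = {x\<in>B1. \<forall>p. subgradient_at v x p \<longrightarrow>
      (\<exists>C>0. \<exists>h0>0. \<forall>h. 0 < h \<and> h < h0 \<longrightarrow>
         measure lebesgue (section_set v h p x) < C * h powr ((real DIM('a) + 1) / 2))}"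

text \<open>Hausdorff measure of integer dimension s (Carath\'eodory construction, normalised
  by the volume of the unit ball omega_s = pi^(s/2)/Gamma(s/2+1); empty cover sets contribute 0).\<close>
definition hausdorff_pre :: "nat \<Rightarrow> real \<Rightarrow> 'a::metric_space set \<Rightarrow> ennreal" where
  "hausdorff_pre s \<delta> A =
     (INF C \<in> {C :: nat \<Rightarrow> 'a set. A \<subseteq> (\<Union>j. C j) \<and> (\<forall>j. bounded (C j) \<and> diameter (C j) \<le> \<delta>)}.
        (\<Sum>j. ennreal (if C j = {} then 0
                 else pi powr (real s / 2) / Gamma (real s / 2 + 1) * (diameter (C j) / 2) ^ s)))"

definition hausdorff_measure :: "nat \<Rightarrow> 'a::metric_space set \<Rightarrow> ennreal" where
  "hausdorff_measure s A = (SUP \<delta> \<in> {0<..}. hausdorff_pre s \<delta> A)"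

end

theory Submission
  imports Defs
begin

text \<open>
  Put \<open>w = v + |x|\<^sup>2/2\<close>. Sections of \<open>w\<close> at height \<open>h = r\<^sup>2/2\<close> lie in the ball of radius \<open>r\<close>, and a
  section \<open>T\<close> is mapped by the subdifferential of \<open>w\<close> onto a set containing a dilate by \<open>h\<close> of the polar
  of \<open>T - x\<close>, whose volume is at least of order \<open>h\<^sup>n / |T|\<close>. Hence at points of \<open>\<Sigma>\<^sub>v\<close> the Monge-Ampere
  measure of \<open>w\<close> gives \<open>T\<close> mass at least of order \<open>r\<^sup>n\<^sup>-\<^sup>1\<close>.

  Take \<open>p\<close> to be a subgradient of maximal norm. Then \<open>T\<close> is not contained in slabs of width of order
  \<open>h\<close> for all small \<open>h\<close>; as \<open>|T|\<close> is of order \<open>r\<^sup>n\<^sup>+\<^sup>1\<close>, there must be arbitrarily small \<open>r\<close> for which \<open>T\<close>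
  is much thinner than \<open>r\<close> in two orthogonal directions. So a fixed multiple of \<open>r\<^sup>n\<^sup>-\<^sup>1\<close> of a finite measure
  sits in a set of much smaller \<open>(n-1)\<close>-dimensional content, and a Vitali covering argument shows
  that the set of such points is null for the \<open>(n-1)\<close>-dimensional Hausdorff measure.
\<close>

section \<open>Lebesgue measure under linear maps\<close>

text \<open>Mass of order \<open>r^(n-1)\<close> at small scales would by itself only bound the
  \<open>(n-1)\<close>-dimensional measure; nullity comes from finding this mass in a set of smaller
  content. One thin direction is not enough, since a flat disc of radius \<open>r\<close> still has
  content of order \<open>r^(n-1)\<close>. With two directions of width below \<open>r/m\<close>,
  about \<open>m^(n-2)\<close> balls of radius of order \<open>r/m\<close> suffice, which gains a
  factor of order \<open>1/m\<close>. The two directions come from counting: the widths multiply to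
  at most a constant times \<open>r^(n+1)\<close> and each exceeds a prescribed multiple of
  \<open>h = r^2/2\<close>; if only one were below \<open>r/m\<close>, the product would be too
  large.

  The paraboloid has a second use: it gives \<open>I + \<partial>v\<close> a 1-Lipschitz inverse, so
  that the Monge-Ampere measure is a push-forward of Lebesgue measure. Polar volumes are estimated
  through an orthonormal box around the section, in place of a volume-product inequality. The space
  is an arbitrary Euclidean space, so the determinants behind the box come from Fubini and
  invariance, without matrices.\<close>

lemma borel_measurable_linear:
  fixes L :: "'a::euclidean_space \<Rightarrow> 'b::euclidean_space"
  assumes "linear L"
  shows "L \<in> borel_measurable borel"
  using assms by (intro borel_measurable_continuous_onI linear_continuous_on)
    (simp add: linear_conv_bounded_linear)

lemma nn_integral_lborel_reflect:
  fixes f :: "'a::euclidean_space \<Rightarrow> ennreal"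
  assumes [measurable]: "f \<in> borel_measurable borel"
  shows "(\<integral>\<^sup>+x. f (c - x) \<partial>lborel) = (\<integral>\<^sup>+x. f x \<partial>lborel)"
proof -
  have "(\<integral>\<^sup>+x. f x \<partial>lborel) = (\<integral>\<^sup>+x. f x \<partial>(distr lborel borel (\<lambda>x. c + (-1) *\<^sub>R x)))"
    by (subst lborel_affine[of "-1" c]) (auto simp: density_1)
  also have "\<dots> = (\<integral>\<^sup>+x. f (c - x) \<partial>lborel)"
    by (subst nn_integral_distr) auto
  finally show ?thesis by simp
qed

lemma emeasure_lborel_translate_vimage:
  fixes A :: "'a::euclidean_space set"
  assumes [measurable]: "A \<in> sets borel"
  shows "emeasure lborel ((\<lambda>y. y - c) -` A) = emeasure lborel A"
proof -
  have "emeasure lborel A = emeasure (distr lborel borel ((+) (-c))) A"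
    by (simp add: lborel_distr_plus)
  also have "\<dots> = emeasure lborel ((\<lambda>y. y - c) -` A)"
    by (subst emeasure_distr) (auto intro!: arg_cong[where f="emeasure lborel"])
  finally show ?thesis by simp
qed

text \<open>Uniqueness of translation-invariant measures, via Fubini for \<open>\<integral>\<integral> 1\<^sub>A(Lx) 1\<^sub>B(y - Lx)\<close>.\<close>
lemma emeasure_lborel_linear_vimage_cross:
  fixes L :: "'a::euclidean_space \<Rightarrow> 'a"
  assumes "linear L" "surj L" and [measurable]: "A \<in> sets borel" "B \<in> sets borel"
  shows "emeasure lborel (L -` A) * emeasure lborel B = emeasure lborel (L -` B) * emeasure lborel A"
proof -
  have [measurable]: "L \<in> borel_measurable borel"
    using assms(1) by (rule borel_measurable_linear)
  define J where "J A B = (\<integral>\<^sup>+x. \<integral>\<^sup>+y. indicator A (L x) * indicator B (y - L x) \<partial>lborel \<partial>lborel)"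
    for A B :: "'a set"
  have J: "J A B = emeasure lborel (L -` A) * emeasure lborel B"
    if [measurable]: "A \<in> sets borel" "B \<in> sets borel" for A B
  proof -
    have "(\<integral>\<^sup>+y. indicator B (y - L x) \<partial>lborel) = emeasure lborel B" for x
    proof -
      have "(\<integral>\<^sup>+y. indicator B (y - L x) \<partial>lborel) = (\<integral>\<^sup>+y. indicator ((\<lambda>y. y - L x) -` B) y \<partial>lborel)"
        by (simp add: indicator_def vimage_def)
      also have "\<dots> = emeasure lborel ((\<lambda>y. y - L x) -` B)"
        by (intro nn_integral_indicator) (simp add: measurable_sets_borel[where M=borel])
      finally show ?thesis by (simp add: emeasure_lborel_translate_vimage)
    qed
    then have "J A B = (\<integral>\<^sup>+x. indicator A (L x) * emeasure lborel B \<partial>lborel)"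
      unfolding J_def by (simp add: nn_integral_cmult)
    also have "\<dots> = (\<integral>\<^sup>+x. indicator (L -` A) x * emeasure lborel B \<partial>lborel)"
      by (simp add: indicator_def vimage_def)
    also have "\<dots> = emeasure lborel (L -` A) * emeasure lborel B"
      by (subst nn_integral_multc) (auto simp: measurable_sets_borel[where M=borel])
    finally show ?thesis .
  qed
  have "J A B = (\<integral>\<^sup>+y. \<integral>\<^sup>+x. indicator A (L x) * indicator B (y - L x) \<partial>lborel \<partial>lborel)"
    unfolding J_def by (subst lborel_pair.Fubini') auto
  also have "\<dots> = (\<integral>\<^sup>+y. \<integral>\<^sup>+x. indicator B (L x) * indicator A (y - L x) \<partial>lborel \<partial>lborel)"
  proof (rule nn_integral_cong)
    fix y :: 'a
    \<comment> \<open>The reflection \<open>x \<mapsto> c - x\<close> exchanges \<open>L x\<close>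
      and \<open>y - L x\<close>, which swaps the roles of \<open>A\<close> and
      \<open>B\<close>.\<close>
    obtain c where c: "y = L c" using assms(2) by (metis surj_def)
    have "(\<integral>\<^sup>+x. indicator A (L x) * indicator B (y - L x) \<partial>lborel) =
      (\<integral>\<^sup>+x. indicator A (L (c - x)) * indicator B (y - L (c - x)) \<partial>lborel)"
      using nn_integral_lborel_reflect[of "\<lambda>x. indicator A (L x) * indicator B (y - L x)" c] by simp
    also have "\<dots> = (\<integral>\<^sup>+x. indicator B (L x) * indicator A (y - L x) \<partial>lborel)"
      by (simp add: linear_diff[OF assms(1)] c mult.commute)
    finally show "(\<integral>\<^sup>+x. indicator A (L x) * indicator B (y - L x) \<partial>lborel) =
      (\<integral>\<^sup>+x. indicator B (L x) * indicator A (y - L x) \<partial>lborel)" .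
  qed
  also have "\<dots> = J B A"
    unfolding J_def by (subst lborel_pair.Fubini') auto
  finally show ?thesis by (simp add: J)
qed

text \<open>The cross identity makes the scaling factor independent of the set, so it can be read
  off from one convenient test set \<open>B\<close>. Here \<open>c\<close> plays the role of
  \<open>1 / |det L|\<close>.\<close>

lemma emeasure_lborel_linear_vimage:
  fixes L :: "'a::euclidean_space \<Rightarrow> 'a"
  assumes "linear L" "surj L" "A \<in> sets borel" "B \<in> sets borel"
    and B: "emeasure lborel B \<noteq> 0" "emeasure lborel B \<noteq> \<infinity>"
    and eq: "emeasure lborel (L -` B) = c * emeasure lborel B"
  shows "emeasure lborel (L -` A) = c * emeasure lborel A"
proof -
  have "emeasure lborel B * emeasure lborel (L -` A) = emeasure lborel B * (c * emeasure lborel A)"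
    using emeasure_lborel_linear_vimage_cross[OF assms(1-4)] eq by (simp add: ac_simps)
  then show ?thesis
    using B by (simp add: ennreal_mult_cancel_left)
qed

lemma emeasure_lborel_unit_ball:
  "emeasure lborel (ball (0::'a::euclidean_space) 1) \<noteq> 0"
  "emeasure lborel (ball (0::'a::euclidean_space) 1) \<noteq> \<infinity>"
  using emeasure_lborel_ball_finite[of "0::'a" 1]
  using less_imp_neq[OF unit_ball_vol_pos[of "real DIM('a)"]]
  by (auto simp: emeasure_ball)

section \<open>Volume factors of reflections, scalings and shears\<close>

lemma orthogonal_transformation_emeasure_vimage:
  fixes U :: "'a::euclidean_space \<Rightarrow> 'a"
  assumes "orthogonal_transformation U" "A \<in> sets borel"
  shows "emeasure lborel (U -` A) = emeasure lborel A"
proof -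
  have "U -` ball 0 1 = ball 0 1"
    using assms(1) by (auto simp: orthogonal_transformation)
  then show ?thesis
    using emeasure_lborel_linear_vimage[of U A "ball 0 1" 1] assms emeasure_lborel_unit_ball[where 'a='a]
    by (simp add: orthogonal_transformation_linear orthogonal_transformation_surj)
qed

text \<open>This is the reflection in the hyperplane orthogonal to \<open>w\<close>; for
  \<open>w = 0\<close> the subtracted term vanishes and the map is the identity.\<close>

lemma orthogonal_transformation_householder:
  fixes w :: "'a::euclidean_space"
  shows "orthogonal_transformation (\<lambda>z. z - (2 * (z \<bullet> w) / (w \<bullet> w)) *\<^sub>R w)"
proof -
  have lin: "linear (\<lambda>z. z - (2 * (z \<bullet> w) / (w \<bullet> w)) *\<^sub>R w)"
    by (rule linearI) (auto simp: algebra_simps add_divide_distrib)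
  show ?thesis
    unfolding orthogonal_transformation_def
    using lin by (cases "w = 0") (auto simp: inner_diff_left inner_diff_right inner_commute field_simps)
qed

lemma orthogonal_transformation_exists_unit:
  fixes a b :: "'a::euclidean_space"
  assumes "norm a = 1" "norm b = 1"
  obtains U where "orthogonal_transformation U" "U a = b"
proof -
  have ab: "a \<bullet> a = 1" "b \<bullet> b = 1" using assms by (auto simp: norm_eq_1)
  \<comment> \<open>Two vectors of equal length are exchanged by the reflection in the hyperplane
    orthogonal to their difference.\<close>
  define w where "w = a - b"
  have "a - (2 * (a \<bullet> w) / (w \<bullet> w)) *\<^sub>R w = b"
  proof (cases "w = 0")
    case False
    have "w \<bullet> w = 2 * (a \<bullet> w)"
      using ab by (simp add: w_def inner_diff_left inner_diff_right inner_commute)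
    then have "2 * (a \<bullet> w) / (w \<bullet> w) = 1" using False by (metis divide_self inner_eq_zero_iff)
    then show ?thesis by (simp only: w_def) simp
  qed (simp add: w_def)
  then show ?thesis
    using that orthogonal_transformation_householder[of w] by blast
qed

text \<open>The map stretches by \<open>d\<close> along \<open>f\<close>. The test set is a unit
  cube rotated so that \<open>f\<close> becomes an axis: its preimage is a rotated box with one side
  \<open>1 / d\<close> and all others 1.\<close>

lemma emeasure_lborel_scale_along:
  fixes f :: "'a::euclidean_space"
  assumes f: "norm f = 1" and d: "d > 0" and A: "A \<in> sets borel"
  shows "emeasure lborel ((\<lambda>z. z + ((d - 1) * (z \<bullet> f)) *\<^sub>R f) -` A) = ennreal (1 / d) * emeasure lborel A"
proof -
  define S where "S = (\<lambda>z. z + ((d - 1) * (z \<bullet> f)) *\<^sub>R f)"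
  obtain b :: 'a where b: "b \<in> Basis" using nonempty_Basis by blast
  obtain U where U: "orthogonal_transformation U" "U f = b"
    using orthogonal_transformation_exists_unit[OF f norm_Basis[OF b]] by blast
  have linU: "linear U" using U(1) by (rule orthogonal_transformation_linear)
  have ff: "f \<bullet> f = 1" using f by (simp add: norm_eq_1)
  have Ub: "U z \<bullet> b = z \<bullet> f" for z
    using U by (metis orthogonal_transformation_def)
  have [measurable]: "U \<in> borel_measurable borel"
    using linU by (rule borel_measurable_linear)
  define B where "B = U -` cbox 0 One"
  have Bs: "B \<in> sets borel"
    unfolding B_def by (simp add: measurable_sets_borel[where M=borel])
  have eB: "emeasure lborel B = 1"
    unfolding B_def by (simp add: orthogonal_transformation_emeasure_vimage[OF U(1)] emeasure_lborel_cbox)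
  have "S -` B = U -` (cbox 0 (One + (1 / d - 1) *\<^sub>R b))"
  proof -
    have "U (S z) = U z + ((d - 1) * (U z \<bullet> b)) *\<^sub>R b" for z
      unfolding S_def by (simp add: linear_add[OF linU] linear_scale[OF linU] U(2) Ub)
    moreover have "w + ((d - 1) * (w \<bullet> b)) *\<^sub>R b \<in> cbox 0 One \<longleftrightarrow> w \<in> cbox 0 (One + (1 / d - 1) *\<^sub>R b)" for w
    proof -
      have "(w + ((d - 1) * (w \<bullet> b)) *\<^sub>R b) \<bullet> i = (if i = b then d * (w \<bullet> i) else w \<bullet> i)" if "i \<in> Basis" for i
        using b that by (auto simp: inner_add_left inner_Basis algebra_simps)
      moreover have "(One + (1 / d - 1) *\<^sub>R b) \<bullet> i = (if i = b then 1 / d else 1)" if "i \<in> Basis" for i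
        using b that by (auto simp: inner_add_left inner_Basis)
      moreover have "0 \<le> d * t \<longleftrightarrow> 0 \<le> t" "d * t \<le> 1 \<longleftrightarrow> t \<le> 1 / d" for t
        using d by (auto simp: zero_le_mult_iff field_simps)
      ultimately show ?thesis
        by (simp add: mem_box)
    qed
    ultimately show ?thesis unfolding B_def by auto
  qed
  then have "emeasure lborel (S -` B) = emeasure lborel (cbox 0 (One + (1 / d - 1) *\<^sub>R b))"
    by (simp add: orthogonal_transformation_emeasure_vimage[OF U(1)])
  also have "\<dots> = ennreal (\<Prod>i\<in>Basis. if i = b then 1 / d else 1)"
  proof -
    have *: "(One + (1 / d - 1) *\<^sub>R b) \<bullet> i = (if i = b then 1 / d else 1)" if "i \<in> Basis" for i
      using b that by (auto simp: inner_add_left inner_Basis)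
    show ?thesis
      using d by (subst emeasure_lborel_cbox) (simp_all add: * cong: prod.cong)
  qed
  also have "\<dots> = ennreal (1 / d)"
    using b by simp
  finally have SB: "emeasure lborel (S -` B) = ennreal (1 / d) * emeasure lborel B"
    by (simp add: eB)
  have linS: "linear S"
    unfolding S_def by (rule linearI) (auto simp: algebra_simps)
  have surjS: "surj S"
  proof (rule surjI)
    show "S (z + ((1 / d - 1) * (z \<bullet> f)) *\<^sub>R f) = z" for z
    proof -
      have "(z + ((1 / d - 1) * (z \<bullet> f)) *\<^sub>R f) \<bullet> f = (z \<bullet> f) / d"
        using ff by (simp add: inner_add_left left_diff_distrib)
      moreover have "(1 / d - 1) * (z \<bullet> f) + (d - 1) * ((z \<bullet> f) / d) = 0"
        using d by (simp add: field_simps)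
      ultimately show ?thesis
        unfolding S_def by (metis add.assoc add.right_neutral scaleR_left_distrib scaleR_zero_left)
    qed
  qed
  have "emeasure lborel (S -` A) = ennreal (1 / d) * emeasure lborel A"
    by (rule emeasure_lborel_linear_vimage[OF linS surjS A Bs _ _ SB]) (simp_all add: eB)
  then show ?thesis unfolding S_def .
qed

lemma ennreal_square_cancel:
  fixes a b :: ennreal
  assumes "a * a = b * b"
  shows "a = b"
proof -
  have "\<not> x < y" if "x * x = y * y" for x y :: ennreal
  proof
    assume "x < y"
    then have "0 < y" "x < top" by (auto simp: less_top[symmetric] intro: le_less_trans[of 0 x y])
    then have "y \<noteq> top"
      using that by (auto simp: ennreal_mult_eq_top_iff)
    then have "x * y < y * y"
      using \<open>x < y\<close> \<open>0 < y\<close> by (intro ennreal_mult_strict_right_mono) (auto simp: less_top)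
    moreover have "x * x \<le> x * y"
      using \<open>x < y\<close> by (auto intro: mult_mono)
    ultimately show False using that by simp
  qed
  from this[of a b] this[of b a] assms show ?thesis by force
qed

text \<open>Reflection in the hyperplane orthogonal to \<open>f\<close> conjugates the shear to its
  inverse, so both have the same factor; their composition is the identity, so this factor squares
  to 1.\<close>

lemma emeasure_lborel_shear:
  fixes f u :: "'a::euclidean_space"
  assumes fu: "f \<bullet> u = 0" and A: "A \<in> sets borel"
  shows "emeasure lborel ((\<lambda>z. z + (z \<bullet> f) *\<^sub>R u) -` A) = emeasure lborel A"
proof -
  define M where "M u = (\<lambda>z. z + (z \<bullet> f) *\<^sub>R u)" for u :: 'a
  define R where "R = (\<lambda>z. z - (2 * (z \<bullet> f) / (f \<bullet> f)) *\<^sub>R f)"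
  define B :: "'a set" where "B = ball 0 1"
  have R: "orthogonal_transformation R"
    unfolding R_def by (rule orthogonal_transformation_householder)
  have linM: "linear (M u)" for u
    unfolding M_def by (rule linearI) (auto simp: algebra_simps)
  have [measurable]: "M u \<in> borel_measurable borel" for u
    using linM by (rule borel_measurable_linear)
  have inv: "M u (M (-u) z) = z" for z
    using fu by (simp add: M_def inner_add_left inner_diff_left inner_commute[of u f])
  then have surj: "surj (M u)" by (metis surjI)
  have inv': "M (-u) (M u z) = z" for z
    using fu by (simp add: M_def inner_add_left inner_diff_left inner_commute[of u f])
  have conj: "M (-u) z = R (M u (R z))" for z
  proof (cases "f = 0")
    case False
    then have "R z \<bullet> f = - (z \<bullet> f)" "M u (R z) \<bullet> f = - (z \<bullet> f)"
      using fu by (auto simp: R_def M_def inner_diff_left inner_add_left inner_commute[of u f])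
    then show ?thesis
      using False fu by (simp add: M_def R_def)
  qed (simp add: M_def R_def)
  have RB: "R -` B = B"
    using R by (auto simp: orthogonal_transformation B_def)
  have Bs: "M v -` B \<in> sets borel" for v
    unfolding B_def by (simp add: measurable_sets_borel[where M=borel])
  define k where "k = emeasure lborel (M u -` B)"
  have "M (-u) -` B = R -` (M u -` (R -` B))"
    by (auto simp: conj)
  then have k': "emeasure lborel (M (-u) -` B) = k"
    unfolding k_def RB by (simp add: orthogonal_transformation_emeasure_vimage[OF R] Bs)
  have "M u -` (M (-u) -` B) = B" by (auto simp: inv')
  then have "emeasure lborel B * emeasure lborel B = k * k"
    using emeasure_lborel_linear_vimage_cross[OF linM surj Bs[of "-u"], of B] k' k_def
    by (simp add: B_def)
  then have "emeasure lborel B = k"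
    by (rule ennreal_square_cancel)
  then have "emeasure lborel (M u -` A) = 1 * emeasure lborel A"
    using emeasure_lborel_unit_ball[where 'a='a]
    by (intro emeasure_lborel_linear_vimage[OF linM surj A, of B]) (auto simp: k_def B_def)
  then show ?thesis unfolding M_def by simp
qed

text \<open>The map fixes the hyperplane orthogonal to \<open>f\<close> and sends \<open>f\<close>
  to \<open>y\<close>, so its determinant is \<open>d\<close>. It is a stretch by \<open>d\<close>
  along \<open>f\<close> followed by a shear in the direction of the component of \<open>y\<close>
  orthogonal to \<open>f\<close>.\<close>

lemma emeasure_lborel_rank_one:
  fixes f y :: "'a::euclidean_space"
  assumes f: "norm f = 1" and d: "y \<bullet> f = d" "d > 0" and A: "A \<in> sets borel"
  shows "emeasure lborel A = ennreal d * emeasure lborel ((\<lambda>z. z + (z \<bullet> f) *\<^sub>R (y - f)) -` A)"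
proof -
  define u where "u = (1 / d) *\<^sub>R (y - d *\<^sub>R f)"
  have ff: "f \<bullet> f = 1" using f by (simp add: norm_eq_1)
  have "f \<bullet> u = 0" using d ff by (simp add: u_def inner_diff_right inner_commute)
  define M where "M = (\<lambda>z. z + (z \<bullet> f) *\<^sub>R u)"
  define S where "S = (\<lambda>z. z + ((d - 1) * (z \<bullet> f)) *\<^sub>R f)"
  have "z + (z \<bullet> f) *\<^sub>R (y - f) = M (S z)" for z
  proof -
    have "S z \<bullet> f = d * (z \<bullet> f)" by (simp add: S_def inner_add_left ff algebra_simps)
    then show ?thesis using d by (simp add: M_def S_def u_def algebra_simps)
  qed
  then have eq: "(\<lambda>z. z + (z \<bullet> f) *\<^sub>R (y - f)) -` A = S -` (M -` A)" by auto
  have "linear M" unfolding M_def by (rule linearI) (auto simp: algebra_simps)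
  then have [measurable]: "M \<in> borel_measurable borel"
    by (rule borel_measurable_linear)
  have "M -` A \<in> sets borel" using A by (simp add: measurable_sets_borel[where M=borel])
  then have "emeasure lborel (S -` (M -` A)) = ennreal (1 / d) * emeasure lborel A"
    using emeasure_lborel_scale_along[OF f d(2)] emeasure_lborel_shear[OF \<open>f \<bullet> u = 0\<close> A]
    unfolding S_def M_def by simp
  then show ?thesis
    using d by (simp add: eq mult.assoc[symmetric] ennreal_mult'[symmetric])
qed

lemma emeasure_lborel_orthonormal_box:
  fixes F :: "'a::euclidean_space set"
  assumes F: "pairwise orthogonal F" "\<And>f. f \<in> F \<Longrightarrow> norm f = 1" "card F = DIM('a)"
    and ab: "\<And>f. f \<in> F \<Longrightarrow> a f \<le> b f"
  shows "emeasure lborel {z. \<forall>f\<in>F. a f \<le> z \<bullet> f \<and> z \<bullet> f \<le> b f} = ennreal (\<Prod>f\<in>F. b f - a f)"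
proof -
  have "finite F" using F(3) DIM_positive[where 'a='a] by (metis card.infinite less_irrefl)
  then obtain \<sigma> where \<sigma>: "bij_betw \<sigma> (Basis::'a set) F"
    using F(3) by (metis finite_Basis finite_same_card_bij)
  have \<sigma>F: "\<sigma> i \<in> F" if "i \<in> Basis" for i using \<sigma> that by (auto simp: bij_betw_def)
  have \<sigma>\<sigma>: "\<sigma> i \<bullet> \<sigma> j = i \<bullet> j" if ij: "i \<in> Basis" "j \<in> Basis" for i j
  proof (cases "i = j")
    case True
    then show ?thesis using ij F(2)[OF \<sigma>F[OF ij(1)]] by (simp add: norm_eq_1)
  next
    case False
    then have "\<sigma> i \<noteq> \<sigma> j" using \<sigma> ij by (auto simp: bij_betw_def inj_on_def)
    then show ?thesis
      using F(1) \<sigma>F ij False by (auto simp: pairwise_def orthogonal_def inner_not_same_Basis)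
  qed
  define U where "U z = (\<Sum>i\<in>Basis. (z \<bullet> i) *\<^sub>R \<sigma> i)" for z
  have Uf: "U z \<bullet> \<sigma> i = z \<bullet> i" if "i \<in> Basis" for z i
  proof -
    have "U z \<bullet> \<sigma> i = (\<Sum>j\<in>Basis. (z \<bullet> j) * (j \<bullet> i))"
      unfolding U_def inner_sum_left using that by (intro sum.cong) (auto simp: \<sigma>\<sigma>)
    also have "\<dots> = z \<bullet> i"
      using that by (simp add: inner_Basis if_distrib sum.If_cases)
    finally show ?thesis .
  qed
  have linU: "linear U"
    unfolding U_def by (rule linearI) (auto simp: algebra_simps sum.distrib scaleR_sum_right)
  have "U z \<bullet> U w = z \<bullet> w" for z w
  proof -
    have "U z \<bullet> U w = (\<Sum>i\<in>Basis. (w \<bullet> i) * (z \<bullet> i))"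
      by (subst (2) U_def) (simp add: inner_sum_right Uf)
    also have "\<dots> = z \<bullet> w" by (subst euclidean_inner[of z w]) (simp add: mult.commute)
    finally show ?thesis .
  qed
  then have U: "orthogonal_transformation U"
    using linU by (auto simp: orthogonal_transformation_def)
  define X where "X = {z. \<forall>f\<in>F. a f \<le> z \<bullet> f \<and> z \<bullet> f \<le> b f}"
  have "X = (\<Inter>f\<in>F. {z. f \<bullet> z \<ge> a f} \<inter> {z. f \<bullet> z \<le> b f})"
    by (auto simp: X_def inner_commute)
  then have "closed X"
    by (auto intro!: closed_INT closed_Int closed_halfspace_ge closed_halfspace_le)
  then have Xs: "X \<in> sets borel" by simp
  have "U -` X = {z. \<forall>i\<in>Basis. a (\<sigma> i) \<le> z \<bullet> i \<and> z \<bullet> i \<le> b (\<sigma> i)}"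
    using \<sigma> Uf by (auto simp: X_def bij_betw_def)
  also have "\<dots> = cbox (\<Sum>i\<in>Basis. a (\<sigma> i) *\<^sub>R i) (\<Sum>i\<in>Basis. b (\<sigma> i) *\<^sub>R i)"
    by (auto simp: mem_box)
  finally have "emeasure lborel X = emeasure lborel (cbox (\<Sum>i\<in>Basis. a (\<sigma> i) *\<^sub>R i) (\<Sum>i\<in>Basis. b (\<sigma> i) *\<^sub>R i :: 'a))"
    using orthogonal_transformation_emeasure_vimage[OF U Xs] by simp
  also have "\<dots> = ennreal (\<Prod>i\<in>Basis. b (\<sigma> i) - a (\<sigma> i))"
    using ab \<sigma>F by (subst emeasure_lborel_cbox)
      (auto simp: inner_diff_left intro!: arg_cong[where f=ennreal] prod.cong)
  also have "(\<Prod>i\<in>Basis. b (\<sigma> i) - a (\<sigma> i)) = (\<Prod>f\<in>F. b f - a f)"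
    using prod.reindex_bij_betw[OF \<sigma>, of "\<lambda>f. b f - a f"] by simp
  finally show ?thesis by (simp add: X_def)
qed

section \<open>Orthonormal boxes around convex bodies\<close>

lemma orthonormal_frame_expand:
  fixes F :: "'a::euclidean_space set"
  assumes "finite F" "card F = DIM('a)" "pairwise orthogonal F" "\<And>f. f \<in> F \<Longrightarrow> norm f = 1"
  shows "(\<Sum>f\<in>F. (y \<bullet> f) *\<^sub>R f) = y"
proof -
  have "0 \<notin> F" using assms(4) by force
  then have "independent F" using assms(3) by (rule pairwise_orthogonal_independent[rotated])
  then have "span F = UNIV"
    using card_ge_dim_independent[of F UNIV] assms(2) by auto
  then show ?thesis by (intro orthonormal_basis_expand) (use assms in auto)
qed

text \<open>Take \<open>y\<close> in \<open>T\<close> at maximal distance from \<open>span F\<close>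
  and let \<open>f\<close> be its normalised component orthogonal to that span. The distance is
  positive because \<open>T\<close> has interior points and a proper subspace has none.\<close>

lemma greedy_orthonormal_step:
  fixes T :: "'a::euclidean_space set"
  assumes T: "compact T" "0 \<in> interior T"
    and F: "finite F" "card F < DIM('a)" "pairwise orthogonal F" "\<And>f. f \<in> F \<Longrightarrow> norm f = 1"
  obtains f y where "norm f = 1" "\<And>g. g \<in> F \<Longrightarrow> g \<bullet> f = 0" "y \<in> T" "y \<in> span (insert f F)"
    "y \<bullet> f > 0" "\<And>z. z \<in> T \<Longrightarrow> \<bar>z \<bullet> f\<bar> \<le> y \<bullet> f"
proof -
  define P where "P z = z - (\<Sum>g\<in>F. (z \<bullet> g) *\<^sub>R g)" for z
  have Pg: "P z \<bullet> g = 0" if g: "g \<in> F" for z g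
  proof -
    have "(\<Sum>h\<in>F. (z \<bullet> h) *\<^sub>R h) \<bullet> g = (\<Sum>h\<in>F. if h = g then z \<bullet> g else 0)"
      unfolding inner_sum_left using F(3,4) g
      by (intro sum.cong) (auto simp: pairwise_def orthogonal_def norm_eq_1)
    then show ?thesis using F(1) g by (simp add: P_def inner_diff_left)
  qed
  have "T \<noteq> {}" using T(2) interior_subset by blast
  moreover have "continuous_on T (\<lambda>z. norm (P z))"
    unfolding P_def by (intro continuous_intros)
  ultimately obtain y where y: "y \<in> T" and ymax: "\<And>z. z \<in> T \<Longrightarrow> norm (P z) \<le> norm (P y)"
    using continuous_attains_sup[OF T(1)] by blast
  have "P y \<noteq> 0"
  proof
    assume "P y = 0"
    then have "P z = 0" if "z \<in> T" for z using ymax[OF that] by simp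
    then have "z = (\<Sum>g\<in>F. (z \<bullet> g) *\<^sub>R g)" if "z \<in> T" for z
      using that unfolding P_def by simp
    moreover have "(\<Sum>g\<in>F. (z \<bullet> g) *\<^sub>R g) \<in> span F" for z
      by (intro span_sum span_scale span_base)
    ultimately have "z \<in> span F" if "z \<in> T" for z
      using that by metis
    then have "interior T \<subseteq> interior (span F)" by (intro interior_mono) blast
    moreover have "interior (span F) = {}"
      using F(2) dim_le_card'[OF F(1)] by (intro empty_interior_lowdim) simp
    ultimately show False using T(2) by blast
  qed
  define f where "f = (1 / norm (P y)) *\<^sub>R P y"
  have nf: "norm f = 1" using \<open>P y \<noteq> 0\<close> by (simp add: f_def)
  have gf: "g \<bullet> f = 0" if "g \<in> F" for g
    using Pg[OF that] by (simp add: f_def inner_commute)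
  have Pf: "z \<bullet> f = P z \<bullet> f" for z
    using gf by (simp add: P_def inner_diff_left inner_sum_left)
  have yf: "y \<bullet> f = norm (P y)"
    using \<open>P y \<noteq> 0\<close> unfolding Pf[of y] by (simp add: f_def dot_square_norm power2_eq_square)
  have "\<bar>z \<bullet> f\<bar> \<le> y \<bullet> f" if "z \<in> T" for z
    using Cauchy_Schwarz_ineq2[of "P z" f] ymax[OF that] unfolding Pf[of z] by (simp add: yf nf)
  moreover have "y \<in> span (insert f F)"
  proof -
    have "y = norm (P y) *\<^sub>R f + (\<Sum>g\<in>F. (y \<bullet> g) *\<^sub>R g)"
      using \<open>P y \<noteq> 0\<close> by (simp add: f_def P_def)
    also have "\<dots> \<in> span (insert f F)"
      by (intro span_add span_sum span_scale span_base) auto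
    finally show ?thesis .
  qed
  ultimately show ?thesis
    using that[OF nf gf y] yf \<open>P y \<noteq> 0\<close> by simp
qed

text \<open>\<open>L\<close> carries the frame to points of \<open>T\<close> and has determinant
  \<open>\<Prod>f\<in>F. d f\<close>, which the last clause expresses through preimages. Being the
  identity on the orthogonal complement lets \<open>L\<close> be extended by one more frame
  vector.\<close>

definition greedy_frame :: "'a::euclidean_space set \<Rightarrow> 'a set \<Rightarrow> ('a \<Rightarrow> real) \<Rightarrow> ('a \<Rightarrow> 'a) \<Rightarrow> bool" where
  "greedy_frame T F d L \<longleftrightarrow> finite F \<and> pairwise orthogonal F \<and>
    (\<forall>f\<in>F. norm f = 1 \<and> d f > 0 \<and> (\<forall>y\<in>T. \<bar>y \<bullet> f\<bar> \<le> d f) \<and> L f \<in> T \<inter> span F) \<and>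
    linear L \<and> (\<forall>z. (\<forall>f\<in>F. z \<bullet> f = 0) \<longrightarrow> L z = z) \<and>
    (\<forall>A\<in>sets borel. emeasure lborel A = ennreal (\<Prod>f\<in>F. d f) * emeasure lborel (L -` A))"

lemma greedy_orthonormal_frame:
  fixes T :: "'a::euclidean_space set"
  assumes T: "compact T" "0 \<in> interior T" and "k \<le> DIM('a)"
  shows "\<exists>F d L. greedy_frame T F d L \<and> card F = k"
  using \<open>k \<le> DIM('a)\<close>
proof (induction k)
  case 0
  show ?case
    by (rule exI[of _ "{}"], rule exI, rule exI[of _ "\<lambda>z. z"])
      (auto simp: greedy_frame_def linear_id[unfolded id_def])
next
  case (Suc k)
  then obtain F d L where G: "greedy_frame T F d L" and cF: "card F = k" by auto
  have G': "finite F" "pairwise orthogonal F"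
    "\<forall>f\<in>F. norm f = 1 \<and> d f > 0 \<and> (\<forall>y\<in>T. \<bar>y \<bullet> f\<bar> \<le> d f) \<and> L f \<in> T \<inter> span F"
    "linear L" "\<forall>z. (\<forall>f\<in>F. z \<bullet> f = 0) \<longrightarrow> L z = z"
    "\<forall>A\<in>sets borel. emeasure lborel A = ennreal (\<Prod>f\<in>F. d f) * emeasure lborel (L -` A)"
    using G unfolding greedy_frame_def by - (elim conjE, assumption)+
  have F: "finite F" "pairwise orthogonal F"
    and Fd: "\<And>f. f \<in> F \<Longrightarrow> norm f = 1" "\<And>f. f \<in> F \<Longrightarrow> d f > 0" "\<And>f y. f \<in> F \<Longrightarrow> y \<in> T \<Longrightarrow> \<bar>y \<bullet> f\<bar> \<le> d f"
      "\<And>f. f \<in> F \<Longrightarrow> L f \<in> T" "\<And>f. f \<in> F \<Longrightarrow> L f \<in> span F"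
    and L: "linear L" "\<And>z. (\<And>f. f \<in> F \<Longrightarrow> z \<bullet> f = 0) \<Longrightarrow> L z = z"
      "\<And>A. A \<in> sets borel \<Longrightarrow> emeasure lborel A = ennreal (\<Prod>f\<in>F. d f) * emeasure lborel (L -` A)"
    using G'(3) by (auto simp: G'(1,2,4,5) intro: bspec[OF G'(6)])
  obtain f y where f: "norm f = 1" "\<And>g. g \<in> F \<Longrightarrow> g \<bullet> f = 0" and y: "y \<in> T" "y \<in> span (insert f F)"
    "y \<bullet> f > 0" "\<And>z. z \<in> T \<Longrightarrow> \<bar>z \<bullet> f\<bar> \<le> y \<bullet> f"
    by (rule greedy_orthonormal_step[OF T F(1) _ F(2) Fd(1)]) (use cF Suc.prems in auto)
  have ff: "f \<bullet> f = 1" using f(1) by (simp add: norm_eq_1)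
  have "f \<notin> F" using f(2) ff by force
  \<comment> \<open>\<open>M\<close> fixes the hyperplane orthogonal to \<open>f\<close>, hence the
    earlier points \<open>L g\<close> in \<open>span F\<close>, and moves \<open>f = L f\<close> to
    \<open>y\<close>; its determinant \<open>y \<bullet> f\<close> is the new factor.\<close>
  define M where "M z = z + (z \<bullet> f) *\<^sub>R (y - f)" for z
  define d' where "d' = d(f := y \<bullet> f)"
  have "linear M" unfolding M_def by (rule linearI) (auto simp: algebra_simps)
  then have Mm[measurable]: "M \<in> borel_measurable borel"
    by (rule borel_measurable_linear)
  have span_f: "z \<bullet> f = 0" if "z \<in> span F" for z
    using orthogonal_to_span[OF that, of f] f(2) by (auto simp: orthogonal_def inner_commute)
  have MLg: "M (L g) = L g" if "g \<in> F" for g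
    using span_f[OF Fd(5)[OF that]] by (simp add: M_def)
  have "L f = f" using f(2) by (intro L(2)) (simp add: inner_commute)
  then have MLf: "M (L f) = y" by (simp add: M_def ff)
  have prod: "(\<Prod>g\<in>insert f F. d' g) = (y \<bullet> f) * (\<Prod>g\<in>F. d g)"
    using F(1) \<open>f \<notin> F\<close> by (auto simp: d'_def intro!: prod.cong)
  have "pairwise orthogonal (insert f F)"
    using F(2) f(2) by (auto simp: pairwise_insert orthogonal_def inner_commute)
  moreover have "norm g = 1 \<and> d' g > 0 \<and> (\<forall>y\<in>T. \<bar>y \<bullet> g\<bar> \<le> d' g) \<and> (M \<circ> L) g \<in> T \<inter> span (insert f F)"
    if "g \<in> insert f F" for g
  proof (cases "g = f")
    case True
    then show ?thesis using f(1) y MLf by (simp add: d'_def)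
  next
    case False
    then have "g \<in> F" using that by simp
    moreover have "L g \<in> span (insert f F)"
      using Fd(5)[OF \<open>g \<in> F\<close>] span_mono[of F "insert f F"] by blast
    ultimately show ?thesis using Fd(1-4) MLg False by (simp add: d'_def)
  qed
  moreover have "linear (M \<circ> L)"
    using \<open>linear M\<close> L(1) by (intro linear_compose)
  moreover have "(M \<circ> L) z = z" if "\<forall>g\<in>insert f F. z \<bullet> g = 0" for z
    using that L(2)[of z] by (simp add: M_def)
  moreover have "emeasure lborel A = ennreal (\<Prod>g\<in>insert f F. d' g) * emeasure lborel ((M \<circ> L) -` A)"
    if A: "A \<in> sets borel" for A
  proof -
    have "emeasure lborel A = ennreal (y \<bullet> f) * emeasure lborel (M -` A)"
      unfolding M_def by (rule emeasure_lborel_rank_one[OF f(1) refl y(3) A])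
    also have "emeasure lborel (M -` A) = ennreal (\<Prod>f\<in>F. d f) * emeasure lborel (L -` (M -` A))"
      using A by (intro L(3)) (simp add: measurable_sets_borel[where M=borel, OF Mm])
    finally show ?thesis
      using y(3) by (simp add: prod ennreal_mult' mult.assoc vimage_comp)
  qed
  ultimately have "greedy_frame T (insert f F) d' (M \<circ> L)"
    unfolding greedy_frame_def using F(1) by (intro conjI ballI allI impI) simp_all
  moreover have "card (insert f F) = Suc k" using F cF \<open>f \<notin> F\<close> by simp
  ultimately show ?case by blast
qed

text \<open>The simplex with vertices \<open>0\<close> and the points \<open>L f\<close> lies in
  \<open>T\<close>, and its volume is the product of the \<open>d f\<close> divided by
  \<open>n!\<close>. The image under \<open>L\<close> of a cube of side \<open>1/n\<close> inside
  the coordinate simplex is easier to measure and only replaces \<open>n!\<close> by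
  \<open>n^n\<close>.\<close>

lemma convex_body_orthonormal_box:
  fixes T :: "'a::euclidean_space set"
  assumes T: "compact T" "0 \<in> interior T" "convex T"
  obtains F d where "finite F" "card F = DIM('a)" "pairwise orthogonal F"
    "\<And>f. f \<in> F \<Longrightarrow> norm f = 1" "\<And>f. f \<in> F \<Longrightarrow> d f > 0"
    "\<And>f y. f \<in> F \<Longrightarrow> y \<in> T \<Longrightarrow> \<bar>y \<bullet> f\<bar> \<le> d f"
    "(\<Prod>f\<in>F. d f) \<le> real DIM('a) ^ DIM('a) * measure lebesgue T"
proof -
  let ?n = "DIM('a)"
  obtain F d L where G: "greedy_frame T F d L" and cF: "card F = ?n"
    using greedy_orthonormal_frame[OF T(1,2), of ?n] by auto
  have G': "finite F" "pairwise orthogonal F"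
    "\<forall>f\<in>F. norm f = 1 \<and> d f > 0 \<and> (\<forall>y\<in>T. \<bar>y \<bullet> f\<bar> \<le> d f) \<and> L f \<in> T \<inter> span F"
    "linear L"
    "\<forall>A\<in>sets borel. emeasure lborel A = ennreal (\<Prod>f\<in>F. d f) * emeasure lborel (L -` A)"
    using G unfolding greedy_frame_def by - (elim conjE, assumption)+
  have F: "finite F" "card F = ?n" "pairwise orthogonal F"
    and Fd: "\<And>f. f \<in> F \<Longrightarrow> norm f = 1" "\<And>f. f \<in> F \<Longrightarrow> d f > 0" "\<And>f y. f \<in> F \<Longrightarrow> y \<in> T \<Longrightarrow> \<bar>y \<bullet> f\<bar> \<le> d f"
      "\<And>f. f \<in> F \<Longrightarrow> L f \<in> T"
    and L: "linear L"
      "\<And>A. A \<in> sets borel \<Longrightarrow> emeasure lborel A = ennreal (\<Prod>f\<in>F. d f) * emeasure lborel (L -` A)"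
    using G'(3) by (auto simp: G'(1,2,4) cF intro: bspec[OF G'(5)])
  define Q where "Q = {z. \<forall>f\<in>F. 0 \<le> z \<bullet> f \<and> z \<bullet> f \<le> 1 / real ?n}"
  have T0: "0 \<in> T" using T(2) interior_subset by blast
  have QT: "Q \<subseteq> L -` T"
  proof
    fix z assume z: "z \<in> Q"
    have "z = (\<Sum>f\<in>F. (z \<bullet> f) *\<^sub>R f)"
      by (rule orthonormal_frame_expand[OF F Fd(1), symmetric])
    then have "L z = L (\<Sum>f\<in>F. (z \<bullet> f) *\<^sub>R f)" by (rule arg_cong)
    also have "\<dots> = (\<Sum>f\<in>F. (z \<bullet> f) *\<^sub>R L f)"
      by (simp add: linear_sum[OF L(1)] linear_scale[OF L(1)])
    finally have Lz: "L z = (\<Sum>f\<in>F. (z \<bullet> f) *\<^sub>R L f)" .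
    have "(\<Sum>f\<in>F. (z \<bullet> f) *\<^sub>R L f) \<in> T"
    proof -
      have "(\<Sum>f\<in>F. z \<bullet> f) \<le> (\<Sum>f\<in>F. 1 / real ?n)"
        using z by (intro sum_mono) (auto simp: Q_def)
      also have "\<dots> = 1" using F(2) by simp
      finally have le: "(\<Sum>f\<in>F. z \<bullet> f) \<le> 1" .
      \<comment> \<open>The index \<open>None\<close> puts the remaining weight on the origin, so
        that the coefficients sum to 1.\<close>
      have "(\<Sum>j\<in>insert None (Some ` F). (case j of None \<Rightarrow> 1 - (\<Sum>f\<in>F. z \<bullet> f) | Some f \<Rightarrow> z \<bullet> f) *\<^sub>R
         (case j of None \<Rightarrow> 0 | Some f \<Rightarrow> L f)) \<in> T"
        using T0 Fd(4) z le F(1)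
        by (intro convex_sum[OF _ T(3)]) (auto simp: sum.reindex Q_def split: option.splits)
      then show ?thesis using F(1) by (simp add: sum.reindex)
    qed
    then show "z \<in> L -` T" by (simp add: Lz)
  qed
  have Ts: "T \<in> sets borel" using T(1) by (intro borel_closed compact_imp_closed)
  have Lm: "L \<in> borel_measurable borel" using L(1) by (rule borel_measurable_linear)
  have eQ: "emeasure lborel Q = ennreal ((1 / real ?n) ^ ?n)"
    unfolding Q_def using F Fd(1) emeasure_lborel_orthonormal_box[of F "\<lambda>_. 0" "\<lambda>_. 1 / real ?n"] by simp
  have fin: "emeasure lborel T < \<infinity>" using T(1) by (rule emeasure_compact_finite)
  have pos: "0 \<le> (\<Prod>f\<in>F. d f)" using Fd(2) by (intro prod_nonneg) (auto simp: less_imp_le)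
  have "ennreal ((\<Prod>f\<in>F. d f) * (1 / real ?n) ^ ?n) = ennreal (\<Prod>f\<in>F. d f) * emeasure lborel Q"
    using pos by (simp add: eQ ennreal_mult')
  also have "\<dots> \<le> ennreal (\<Prod>f\<in>F. d f) * emeasure lborel (L -` T)"
    using QT Ts by (intro mult_left_mono emeasure_mono)
      (auto simp: measurable_sets_borel[where M=borel, OF Lm])
  also have "\<dots> = emeasure lborel T" by (rule L(2)[OF Ts, symmetric])
  also have "\<dots> = ennreal (measure lebesgue T)"
    using fin Ts by (subst emeasure_eq_ennreal_measure) (auto simp: less_top)
  finally have "(\<Prod>f\<in>F. d f) * (1 / real ?n) ^ ?n \<le> measure lebesgue T"
    by (simp add: ennreal_le_iff)
  then have "(\<Prod>f\<in>F. d f) \<le> real ?n ^ ?n * measure lebesgue T"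
    by (simp add: power_divide field_simps)
  then show ?thesis using that[OF F(1,2,3) Fd(1-3)] by blast
qed

section \<open>Subgradients and sections\<close>

text \<open>Moving from \<open>y\<close> towards \<open>x\<close>, convexity lets a violation shrink
  only linearly in \<open>t\<close>, while the tolerated error shrinks quadratically. Local
  minimality statements for \<open>v\<close> plus half a squared norm thus yield global subgradients
  of \<open>v\<close>.\<close>

lemma subgradient_if_locally_up_to_quadratic:
  fixes v :: "'a::euclidean_space \<Rightarrow> real"
  assumes cvx: "convex_on B1 v" and x: "x \<in> B1" and "e > 0"
    and loc: "\<And>y. y \<in> B1 \<Longrightarrow> dist x y < e \<Longrightarrow> v y \<ge> v x + p \<bullet> (y - x) - (norm (y - x))\<^sup>2 / 2"
  shows "subgradient_at v x p"
  unfolding subgradient_at_def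
proof (rule ballI, rule ccontr)
  fix y assume y: "y \<in> B1" and neg: "\<not> v y \<ge> v x + p \<bullet> (y - x)"
  define D where "D = v x + p \<bullet> (y - x) - v y"
  have "D > 0" using neg by (simp add: D_def)
  define N where "N = norm (y - x)"
  have "N \<ge> 0" by (simp add: N_def)
  \<comment> \<open>The second bound puts \<open>z\<close> within \<open>e\<close> of
    \<open>x\<close>, the third makes the quadratic error at \<open>z\<close> smaller than
    \<open>t * D\<close>; adding 1 keeps the denominators positive.\<close>
  define t where "t = min 1 (min (e / (2 * (N + 1))) (D / (N\<^sup>2 + 1)))"
  have t: "0 < t" "t \<le> 1" "t \<le> e / (2 * (N + 1))" "t \<le> D / (N\<^sup>2 + 1)"
    using \<open>e > 0\<close> \<open>D > 0\<close> \<open>N \<ge> 0\<close> by (auto simp: t_def intro!: divide_pos_pos add_nonneg_pos)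
  define z where "z = (1 - t) *\<^sub>R x + t *\<^sub>R y"
  have zx: "z - x = t *\<^sub>R (y - x)" by (simp add: z_def algebra_simps)
  have "z \<in> B1" unfolding z_def using convexD[OF convex_ball x y, of "1 - t" t] t by simp
  moreover have "dist x z < e"
  proof -
    have "dist x z = t * N" using t(1) by (simp add: dist_norm norm_minus_commute[of x z] zx N_def)
    also have "\<dots> \<le> e / (2 * (N + 1)) * N" using t(3) \<open>N \<ge> 0\<close> by (intro mult_right_mono)
    also have "\<dots> < e" using \<open>N \<ge> 0\<close> \<open>e > 0\<close> by (simp add: divide_simps)
    finally show ?thesis .
  qed
  ultimately have "v z \<ge> v x + p \<bullet> (z - x) - (norm (z - x))\<^sup>2 / 2" by (rule loc)
  moreover have "p \<bullet> (z - x) = t * (p \<bullet> (y - x))" "(norm (z - x))\<^sup>2 = t * (t * N\<^sup>2)"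
    using t(1) unfolding zx N_def by (simp_all add: power_mult_distrib power2_eq_square)
  moreover have "v z \<le> (1 - t) * v x + t * v y"
    unfolding z_def using convex_onD[OF cvx, of t x y] t x y by simp
  ultimately have "t * D \<le> t * (t * N\<^sup>2 / 2)"
    by (simp add: D_def algebra_simps)
  then have "D \<le> t * N\<^sup>2 / 2" using t(1) by simp
  also have "\<dots> \<le> D / (N\<^sup>2 + 1) * N\<^sup>2 / 2" using t(4) by (intro divide_right_mono mult_right_mono) auto
  also have "\<dots> < D" using \<open>D > 0\<close> by (simp add: divide_simps add_nonneg_pos)
  finally show False by simp
qed

text \<open>Separate \<open>(x, v x)\<close> from the strict epigraph. As \<open>x\<close> is
  interior to \<open>B1\<close>, the hyperplane cannot be vertical, and its slope is a
  subgradient.\<close>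

lemma subgradient_exists:
  fixes v :: "'a::euclidean_space \<Rightarrow> real"
  assumes cvx: "convex_on B1 v" and x: "x \<in> B1"
  shows "\<exists>p. subgradient_at v x p"
proof -
  define E where "E = {(y, t). y \<in> B1 \<and> v y < t}"
  have "convex E"
  proof (rule convexI)
    fix a b and s u :: real assume ab: "a \<in> E" "b \<in> E" and su: "0 \<le> s" "0 \<le> u" "s + u = 1"
    obtain y1 t1 y2 t2 where eq: "a = (y1, t1)" "b = (y2, t2)" by (cases a, cases b)
    have yt: "y1 \<in> B1" "y2 \<in> B1" "v y1 < t1" "v y2 < t2" using ab by (auto simp: E_def eq)
    have "s *\<^sub>R y1 + u *\<^sub>R y2 \<in> B1" using convexD[OF convex_ball yt(1,2) su] .
    moreover have "v (s *\<^sub>R y1 + u *\<^sub>R y2) \<le> s * v y1 + u * v y2"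
      using cvx yt su by (simp add: convex_on_def)
    moreover have "s * v y1 + u * v y2 < s * t1 + u * t2"
    proof (cases "s = 0")
      case False
      then show ?thesis using yt(3,4) su by (intro add_less_le_mono mult_strict_left_mono mult_left_mono) auto
    qed (use su yt in auto)
    ultimately show "s *\<^sub>R a + u *\<^sub>R b \<in> E" by (simp add: E_def eq)
  qed
  moreover have "(x, v x + 1) \<in> E" using x by (simp add: E_def)
  moreover have "{(x, v x)} \<inter> E = {}" by (auto simp: E_def)
  ultimately have "\<exists>a b. a \<noteq> 0 \<and> (\<forall>w\<in>{(x, v x)}. a \<bullet> w \<le> b) \<and> (\<forall>w\<in>E. b \<le> a \<bullet> w)"
    by (intro separating_hyperplane_sets) auto
  then obtain a b where ab: "a \<noteq> 0" "a \<bullet> (x, v x) \<le> b" "\<And>w. w \<in> E \<Longrightarrow> b \<le> a \<bullet> w"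
    by blast
  obtain q c where a: "a = (q, c)" by (cases a)
  have ineq: "0 \<le> q \<bullet> (y - x) + c * (t - v x)" if "y \<in> B1" "v y < t" for y t
  proof -
    have "q \<bullet> x + c * v x \<le> q \<bullet> y + c * t"
      using ab(2) ab(3)[of "(y, t)"] that by (simp add: E_def a)
    then show ?thesis by (simp add: inner_diff_right right_diff_distrib)
  qed
  have "c \<ge> 0" using ineq[OF x, of "v x + 1"] by simp
  moreover have "c \<noteq> 0"
  proof
    assume "c = 0"
    obtain e where e: "e > 0" "cball x e \<subseteq> B1" using x open_contains_cball_eq[OF open_ball] by blast
    have "q \<noteq> 0" using ab(1) a \<open>c = 0\<close> by (simp add: zero_prod_def)
    define y where "y = x - (e / norm q) *\<^sub>R q"
    have "y \<in> cball x e" using \<open>q \<noteq> 0\<close> e(1) by (simp add: y_def dist_norm)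
    then have "0 \<le> q \<bullet> (y - x)" using ineq[of y "v y + 1"] e(2) \<open>c = 0\<close> by auto
    also have "q \<bullet> (y - x) = - (e * norm q)"
      using \<open>q \<noteq> 0\<close> by (simp add: y_def dot_square_norm power2_eq_square)
    finally show False using \<open>q \<noteq> 0\<close> e(1) by (simp add: mult_le_0_iff)
  qed
  ultimately have "c > 0" by simp
  have "v y \<ge> v x + (- (1 / c) *\<^sub>R q) \<bullet> (y - x)" if y: "y \<in> B1" for y
  proof (rule dense_ge)
    fix t assume "v y < t"
    from ineq[OF y this] \<open>c > 0\<close> show "v x + (- (1 / c) *\<^sub>R q) \<bullet> (y - x) \<le> t"
      by (simp add: field_simps)
  qed
  then show ?thesis unfolding subgradient_at_def by blast
qed

text \<open>A step of length \<open>\<rho>\<close> from \<open>x\<close> along \<open>p\<close>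
  raises \<open>v\<close> by at least \<open>\<rho> * norm p\<close>, while \<open>v\<close> is
  bounded on the larger compact ball of radius \<open>R + \<rho>\<close>.\<close>

lemma subgradients_bounded:
  fixes v :: "'a::euclidean_space \<Rightarrow> real"
  assumes cvx: "convex_on B1 v" and "R < 1"
  obtains K where "\<And>x p. x \<in> cball 0 R \<Longrightarrow> subgradient_at v x p \<Longrightarrow> norm p \<le> K"
proof -
  define \<rho> where "\<rho> = (1 - R) / 2"
  have "\<rho> > 0" "R + \<rho> < 1" using \<open>R < 1\<close> by (auto simp: \<rho>_def field_simps)
  have cont: "continuous_on B1 v" using cvx by (intro convex_on_continuous) auto
  have sub: "cball 0 (R + \<rho>) \<subseteq> (B1 :: 'a set)" using \<open>R + \<rho> < 1\<close> by auto
  have "compact (v ` cball 0 (R + \<rho>))"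
    using continuous_on_subset[OF cont sub] by (intro compact_continuous_image) auto
  then obtain m where m: "\<And>y. y \<in> cball 0 (R + \<rho>) \<Longrightarrow> \<bar>v y\<bar> \<le> m"
    using compact_imp_bounded[of "v ` cball 0 (R + \<rho>)"] unfolding bounded_iff real_norm_def by blast
  have "norm p \<le> 2 * m / \<rho>" if x: "x \<in> cball 0 R" and p: "subgradient_at v x p" for x p
  proof (cases "p = 0")
    case False
    define y where "y = x + (\<rho> / norm p) *\<^sub>R p"
    have "norm y \<le> norm x + \<rho>"
      unfolding y_def using norm_triangle_ineq[of x "(\<rho> / norm p) *\<^sub>R p"] False \<open>\<rho> > 0\<close> by simp
    then have y: "y \<in> cball 0 (R + \<rho>)" "x \<in> cball 0 (R + \<rho>)" using x \<open>\<rho> > 0\<close> by auto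
    have "v y \<ge> v x + p \<bullet> (y - x)" using p y(1) sub unfolding subgradient_at_def by blast
    moreover have "p \<bullet> (y - x) = \<rho> * norm p"
      using False by (simp add: y_def dot_square_norm power2_eq_square)
    ultimately have "\<rho> * norm p \<le> 2 * m" using m[OF y(1)] m[OF y(2)] by linarith
    then show ?thesis using \<open>\<rho> > 0\<close> by (simp add: field_simps)
  next
    case True
    have "x \<in> cball 0 (R + \<rho>)" using x \<open>\<rho> > 0\<close> by auto
    from m[OF this] have "m \<ge> 0" by linarith
    then show ?thesis using True \<open>\<rho> > 0\<close> by simp
  qed
  then show ?thesis using that by blast
qed

lemma max_norm_subgradient:
  fixes v :: "'a::euclidean_space \<Rightarrow> real"
  assumes cvx: "convex_on B1 v" and x: "x \<in> B1"
  obtains p where "subgradient_at v x p" "\<And>q. subgradient_at v x q \<Longrightarrow> norm q \<le> norm p"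
proof -
  let ?P = "{p. subgradient_at v x p}"
  have "norm x < 1" "x \<in> cball 0 (norm x)" using x by auto
  then obtain K where "\<And>p. subgradient_at v x p \<Longrightarrow> norm p \<le> K"
    using subgradients_bounded[OF cvx] by metis
  then have "bounded ?P" by (auto simp: bounded_iff)
  moreover have "?P = (\<Inter>y\<in>B1. {p. (y - x) \<bullet> p \<le> v y - v x})"
    by (auto simp: subgradient_at_def inner_commute algebra_simps)
  then have "closed ?P" by (simp add: closed_INT closed_halfspace_le)
  ultimately have "compact ?P" by (simp add: compact_eq_bounded_closed)
  moreover have "?P \<noteq> {}" using subgradient_exists[OF cvx x] by blast
  ultimately obtain p where "p \<in> ?P" "\<forall>q\<in>?P. norm q \<le> norm p"
    using continuous_attains_sup[of ?P norm] continuous_on_norm_id by blast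
  then show ?thesis using that by blast
qed

text \<open>The image of this graph under \<open>(x, p) \<mapsto> x + p\<close> will be the domain
  of the resolvent; compactness makes that domain measurable with finite volume.\<close>

lemma compact_subgradient_graph:
  fixes v :: "'a::euclidean_space \<Rightarrow> real"
  assumes cvx: "convex_on B1 v" and "R < 1"
  shows "compact {(x, p). x \<in> cball 0 R \<and> subgradient_at v x p}"
proof -
  let ?G = "{(x, p). x \<in> cball 0 R \<and> subgradient_at v x p}"
  obtain K where K: "\<And>x p. x \<in> cball 0 R \<Longrightarrow> subgradient_at v x p \<Longrightarrow> norm p \<le> K"
    using subgradients_bounded[OF assms] by blast
  have "?G \<subseteq> cball 0 R \<times> cball 0 K" using K by auto
  then have "bounded ?G" by (rule bounded_subset[OF bounded_Times[OF bounded_cball bounded_cball]])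
  moreover have "closed ?G"
  proof -
    have cont: "continuous_on B1 v" using cvx by (intro convex_on_continuous) auto
    have sub: "cball 0 R \<subseteq> (B1 :: 'a set)" using \<open>R < 1\<close> by auto
    \<comment> \<open>Over a nonempty index set, the constraint \<open>x \<in> cball 0 R\<close> can
      be moved into every member of the intersection.\<close>
    have "0 \<in> (B1 :: 'a set)" by simp
    then have "?G = (\<Inter>y\<in>B1. (cball 0 R \<times> UNIV) \<inter> (\<lambda>(x, p). v x + p \<bullet> (y - x) - v y) -` {..0})"
      by (auto simp: subgradient_at_def)
    moreover have "closed ((cball 0 R \<times> UNIV) \<inter> (\<lambda>(x, p). v x + p \<bullet> (y - x) - v y) -` {..0})" for y
    proof (rule continuous_closed_preimage)
      have "continuous_on (cball 0 R \<times> UNIV) (\<lambda>w::'a\<times>'a. v (fst w))"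
        by (rule continuous_on_compose2[OF cont]) (use sub in \<open>auto intro!: continuous_intros\<close>)
      then show "continuous_on (cball 0 R \<times> UNIV) (\<lambda>(x, p). v x + p \<bullet> (y - x) - v y)"
        unfolding split_def by (intro continuous_intros)
    qed (auto simp: closed_Times)
    ultimately show ?thesis by (metis (no_types, lifting) closed_INT)
  qed
  ultimately show ?thesis by (simp add: compact_eq_bounded_closed)
qed

section \<open>Sections after adding the paraboloid\<close>

definition paraboloid_gap :: "('a::euclidean_space \<Rightarrow> real) \<Rightarrow> 'a \<Rightarrow> 'a \<Rightarrow> 'a \<Rightarrow> real" where
  "paraboloid_gap v x p y = v y - v x - p \<bullet> (y - x) + (norm (y - x))\<^sup>2 / 2"

text \<open>With \<open>w y = v y + |y|^2/2\<close>, the gap is the height of \<open>w\<close> above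
  the affine function of slope \<open>p + x\<close> that agrees with \<open>w\<close> at
  \<open>x\<close>; so this is a closed section of \<open>w\<close>.\<close>

definition strong_section :: "('a::euclidean_space \<Rightarrow> real) \<Rightarrow> 'a \<Rightarrow> 'a \<Rightarrow> real \<Rightarrow> 'a set" where
  "strong_section v x p h = {y \<in> B1. paraboloid_gap v x p y \<le> h}"

lemma paraboloid_gap_ge:
  assumes "subgradient_at v x p" "y \<in> B1"
  shows "(norm (y - x))\<^sup>2 / 2 \<le> paraboloid_gap v x p y"
proof -
  have "v y \<ge> v x + p \<bullet> (y - x)" using assms unfolding subgradient_at_def by blast
  then show ?thesis by (simp add: paraboloid_gap_def)
qed

lemma paraboloid_gap_self [simp]: "paraboloid_gap v x p x = 0"
  by (simp add: paraboloid_gap_def)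

lemma norm_convex_combination_power2:
  fixes a b :: "'a::real_inner"
  assumes "0 \<le> t" "t \<le> 1"
  shows "(norm ((1 - t) *\<^sub>R a + t *\<^sub>R b))\<^sup>2 \<le> (1 - t) * (norm a)\<^sup>2 + t * (norm b)\<^sup>2"
proof -
  have "(1 - t) * (norm a)\<^sup>2 + t * (norm b)\<^sup>2 - (norm ((1 - t) *\<^sub>R a + t *\<^sub>R b))\<^sup>2 = t * (1 - t) * (norm (a - b))\<^sup>2"
    unfolding power2_norm_eq_inner
    by (simp add: inner_add_left inner_add_right inner_diff_left inner_diff_right inner_commute[of b a])
      (simp add: algebra_simps power2_eq_square)
  moreover have "\<dots> \<ge> 0" using assms by simp
  ultimately show ?thesis by linarith
qed

lemma convex_on_paraboloid_gap:
  fixes v :: "'a::euclidean_space \<Rightarrow> real"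
  assumes "convex_on B1 v"
  shows "convex_on B1 (paraboloid_gap v x p)"
proof (rule convex_onI)
  fix t :: real and y z :: 'a assume t: "0 < t" "t < 1" and yz: "y \<in> B1" "z \<in> B1"
  have eq: "(1 - t) *\<^sub>R y + t *\<^sub>R z - x = (1 - t) *\<^sub>R (y - x) + t *\<^sub>R (z - x)"
    by (simp add: algebra_simps)
  have "v ((1 - t) *\<^sub>R y + t *\<^sub>R z) \<le> (1 - t) * v y + t * v z"
    using convex_onD[OF assms, of t y z] t yz by simp
  moreover have "(norm ((1 - t) *\<^sub>R (y - x) + t *\<^sub>R (z - x)))\<^sup>2 \<le> (1 - t) * (norm (y - x))\<^sup>2 + t * (norm (z - x))\<^sup>2"
    using t by (intro norm_convex_combination_power2) auto
  ultimately show "paraboloid_gap v x p ((1 - t) *\<^sub>R y + t *\<^sub>R z)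
      \<le> (1 - t) * paraboloid_gap v x p y + t * paraboloid_gap v x p z"
    unfolding paraboloid_gap_def eq inner_add_right inner_scaleR_right
    by (simp add: left_diff_distrib right_diff_distrib distrib_left distrib_right diff_divide_distrib)
qed simp

lemma continuous_on_paraboloid_gap:
  fixes v :: "'a::euclidean_space \<Rightarrow> real"
  assumes "convex_on B1 v"
  shows "continuous_on B1 (paraboloid_gap v x p)"
  using convex_on_paraboloid_gap[OF assms] by (intro convex_on_continuous) auto

lemma convex_strong_section:
  assumes "convex_on B1 v"
  shows "convex (strong_section v x p h)"
proof (rule convexI)
  fix y z and s t :: real
  assume yz: "y \<in> strong_section v x p h" "z \<in> strong_section v x p h" and st: "0 \<le> s" "0 \<le> t" "s + t = 1"
  have B: "y \<in> B1" "z \<in> B1" and le: "paraboloid_gap v x p y \<le> h" "paraboloid_gap v x p z \<le> h"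
    using yz by (auto simp: strong_section_def)
  have "paraboloid_gap v x p (s *\<^sub>R y + t *\<^sub>R z) \<le> s * paraboloid_gap v x p y + t * paraboloid_gap v x p z"
    using convex_on_paraboloid_gap[OF assms, of x p] B st unfolding convex_on_def by blast
  also have "\<dots> \<le> s * h + t * h" using le st by (intro add_mono mult_left_mono)
  also have "\<dots> = h" using st(3) by (simp add: distrib_right[symmetric])
  finally show "s *\<^sub>R y + t *\<^sub>R z \<in> strong_section v x p h"
    using convexD[OF convex_ball B st] by (simp add: strong_section_def)
qed

lemma strong_section_subset_cball:
  assumes "subgradient_at v x p" "h \<ge> 0"
  shows "strong_section v x p h \<subseteq> cball x (sqrt (2 * h))"
proof
  fix y assume y: "y \<in> strong_section v x p h"
  then have "(norm (y - x))\<^sup>2 \<le> 2 * h"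
    using paraboloid_gap_ge[OF assms(1), of y] by (auto simp: strong_section_def)
  then have "norm (y - x) \<le> sqrt (2 * h)" by (rule real_le_rsqrt)
  then show "y \<in> cball x (sqrt (2 * h))" by (simp add: dist_norm norm_minus_commute)
qed

lemma compact_strong_section:
  fixes v :: "'a::euclidean_space \<Rightarrow> real"
  assumes "convex_on B1 v" "subgradient_at v x p" "h \<ge> 0" and sub: "cball x (sqrt (2 * h)) \<subseteq> B1"
  shows "compact (strong_section v x p h)"
proof -
  have "strong_section v x p h = cball x (sqrt (2 * h)) \<inter> paraboloid_gap v x p -` {..h}"
    using strong_section_subset_cball[OF assms(2,3)] sub by (auto simp: strong_section_def)
  moreover have "closed (cball x (sqrt (2 * h)) \<inter> paraboloid_gap v x p -` {..h})"
    using continuous_on_subset[OF continuous_on_paraboloid_gap[OF assms(1)] sub]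
    by (intro continuous_closed_preimage) auto
  ultimately show ?thesis
    by (metis bounded_cball bounded_Int compact_eq_bounded_closed)
qed

lemma strong_section_neighbourhood:
  fixes v :: "'a::euclidean_space \<Rightarrow> real"
  assumes "convex_on B1 v" "y \<in> B1" "paraboloid_gap v x p y < h"
  obtains e where "e > 0" "ball y e \<subseteq> strong_section v x p h"
proof -
  have "open (B1 \<inter> paraboloid_gap v x p -` {..<h})"
    using continuous_on_paraboloid_gap[OF assms(1)] by (intro continuous_open_preimage) auto
  moreover have "y \<in> B1 \<inter> paraboloid_gap v x p -` {..<h}" using assms by simp
  ultimately obtain e where "e > 0" "ball y e \<subseteq> B1 \<inter> paraboloid_gap v x p -` {..<h}"
    using open_contains_ball by blast
  then show ?thesis using that[of e] by (force simp: strong_section_def)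
qed

text \<open>At a subgradient of maximal norm the sections cannot be as flat as those of \<open>\<bar>e \<bullet> (y - x)\<bar> / M\<close>:
  otherwise \<open>p + e / M\<close> and \<open>p - e / M\<close> would both be subgradients, and one of them is longer than \<open>p\<close>.\<close>

lemma strong_section_not_in_slab:
  fixes v :: "'a::euclidean_space \<Rightarrow> real"
  assumes cvx: "convex_on B1 v" and x: "x \<in> B1" and p: "subgradient_at v x p"
    and pmax: "\<And>q. subgradient_at v x q \<Longrightarrow> norm q \<le> norm p" and "M > 0" "H > 0"
  shows "\<exists>h. 0 < h \<and> h < H \<and> (\<forall>e. norm e = 1 \<longrightarrow> (\<exists>y\<in>strong_section v x p h. \<bar>(y - x) \<bullet> e\<bar> > M * h))"
proof (rule ccontr)
  assume contr: "\<not> ?thesis"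
  have slab: "\<exists>e. norm e = 1 \<and> (\<forall>y\<in>strong_section v x p h. \<bar>(y - x) \<bullet> e\<bar> \<le> M * h)" if "0 < h" "h < H" for h
    using that contr by (metis not_le)
  define h where "h k = H / real (k + 2)" for k :: nat
  have h: "0 < h k" "h k < H" for k using \<open>H > 0\<close> by (auto simp: h_def divide_simps)
  obtain e where e: "\<And>k. norm (e k) = 1" "\<And>k y. y \<in> strong_section v x p (h k) \<Longrightarrow> \<bar>(y - x) \<bullet> e k\<bar> \<le> M * h k"
    using slab[OF h] by metis
  have "h \<longlonglongrightarrow> 0"
    unfolding h_def using LIMSEQ_ignore_initial_segment[OF lim_const_over_n[of H], of 2] by simp
  \<comment> \<open>The slab estimate holds only on the section of height \<open>h k\<close>. A
    point with larger gap \<open>g\<close> is pulled towards \<open>x\<close> by the factor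
    \<open>t = h k / g\<close> into that section, which gives the bound \<open>M * g\<close>; the
    sum \<open>g + h k\<close> covers both cases.\<close>
  have bound: "\<bar>(y - x) \<bullet> e k\<bar> \<le> M * (paraboloid_gap v x p y + h k)" if y: "y \<in> B1" for y k
  proof -
    define g where "g = paraboloid_gap v x p y"
    have "g \<ge> 0" using paraboloid_gap_ge[OF p y] zero_le_power2[of "norm (y - x)"] unfolding g_def by linarith
    show ?thesis
    proof (cases "g \<le> h k")
      case True
      then have "\<bar>(y - x) \<bullet> e k\<bar> \<le> M * h k" using y by (intro e(2)) (simp add: strong_section_def g_def)
      also have "\<dots> \<le> M * (g + h k)" using \<open>g \<ge> 0\<close> \<open>M > 0\<close> by simp
      finally show ?thesis by (simp add: g_def)
    next
      case False
      define t where "t = h k / g"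
      have t: "0 < t" "t \<le> 1" "t * g = h k" using False h[of k] by (auto simp: t_def)
      define z where "z = (1 - t) *\<^sub>R x + t *\<^sub>R y"
      have "z \<in> B1" unfolding z_def using convexD[OF convex_ball x y, of "1 - t" t] t by simp
      moreover have "paraboloid_gap v x p z \<le> h k"
        using convex_onD[OF convex_on_paraboloid_gap[OF cvx, of x p], of t x y] t x y
        by (simp add: z_def g_def)
      ultimately have "\<bar>(z - x) \<bullet> e k\<bar> \<le> M * h k" by (intro e(2)) (simp add: strong_section_def)
      moreover have "z - x = t *\<^sub>R (y - x)" by (simp add: z_def algebra_simps)
      ultimately have "t * \<bar>(y - x) \<bullet> e k\<bar> \<le> t * (M * g)"
        using t by (simp add: abs_mult ac_simps)
      then have "\<bar>(y - x) \<bullet> e k\<bar> \<le> M * g" using t(1) by simp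
      also have "\<dots> \<le> M * (g + h k)" using h(1)[of k] \<open>M > 0\<close> by simp
      finally show ?thesis by (simp add: g_def)
    qed
  qed
  have "compact (sphere (0::'a) 1)" by simp
  moreover have "\<forall>k. e k \<in> sphere 0 1" using e(1) by simp
  ultimately obtain l r where l: "l \<in> sphere 0 1" "strict_mono r" "(e \<circ> r) \<longlonglongrightarrow> l"
    unfolding compact_def by blast
  have lim: "\<bar>(y - x) \<bullet> l\<bar> \<le> M * paraboloid_gap v x p y" if y: "y \<in> B1" for y
  proof (rule LIMSEQ_le)
    show "(\<lambda>k. \<bar>(y - x) \<bullet> e (r k)\<bar>) \<longlonglongrightarrow> \<bar>(y - x) \<bullet> l\<bar>"
      using l(3) by (intro tendsto_intros) (simp add: o_def)
    have "(h \<circ> r) \<longlonglongrightarrow> 0" by (rule LIMSEQ_subseq_LIMSEQ[OF \<open>h \<longlonglongrightarrow> 0\<close> l(2)])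
    then have "(\<lambda>k. M * (paraboloid_gap v x p y + h (r k))) \<longlonglongrightarrow> M * (paraboloid_gap v x p y + 0)"
      by (intro tendsto_intros) (simp add: o_def)
    then show "(\<lambda>k. M * (paraboloid_gap v x p y + h (r k))) \<longlonglongrightarrow> M * paraboloid_gap v x p y" by simp
    show "\<exists>N. \<forall>k\<ge>N. \<bar>(y - x) \<bullet> e (r k)\<bar> \<le> M * (paraboloid_gap v x p y + h (r k))"
      using bound[OF y] by blast
  qed
  define u where "u = (1 / M) *\<^sub>R l"
  have "u \<noteq> 0" using l(1) \<open>M > 0\<close> by (auto simp: u_def)
  have lim': "\<bar>u \<bullet> (y - x)\<bar> \<le> paraboloid_gap v x p y" if y: "y \<in> B1" for y
  proof -
    have "\<bar>u \<bullet> (y - x)\<bar> = \<bar>(y - x) \<bullet> l\<bar> / M" using \<open>M > 0\<close> by (simp add: u_def inner_commute abs_mult)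
    then show ?thesis using lim[OF y] \<open>M > 0\<close> by (simp add: pos_divide_le_eq mult.commute)
  qed
  \<comment> \<open>The quadratic term inside the gap is exactly the error that the local criterion
    tolerates. The inequality holds on all of \<open>B1\<close>, so any radius would do.\<close>
  have "subgradient_at v x (p + u)" "subgradient_at v x (p - u)"
  proof (rule_tac [!] subgradient_if_locally_up_to_quadratic[OF cvx x zero_less_one])
    fix y :: 'a assume y: "y \<in> B1"
    show "v y \<ge> v x + (p + u) \<bullet> (y - x) - (norm (y - x))\<^sup>2 / 2"
      "v y \<ge> v x + (p - u) \<bullet> (y - x) - (norm (y - x))\<^sup>2 / 2"
      using lim'[OF y] by (simp_all add: paraboloid_gap_def inner_add_left inner_diff_left)
  qed
  then have "norm (p + u) \<le> norm p" "norm (p - u) \<le> norm p" by (simp_all add: pmax)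
  \<comment> \<open>By the parallelogram identity, \<open>p + u\<close> and \<open>p - u\<close>
    cannot both be at most as long as \<open>p\<close> unless \<open>u = 0\<close>.\<close>
  then have "(norm (p + u))\<^sup>2 + (norm (p - u))\<^sup>2 \<le> (norm p)\<^sup>2 + (norm p)\<^sup>2"
    by (intro add_mono power_mono) auto
  moreover have "(norm (p + u))\<^sup>2 + (norm (p - u))\<^sup>2 = 2 * (norm p)\<^sup>2 + 2 * (norm u)\<^sup>2"
    unfolding power2_norm_eq_inner by (simp add: inner_add_left inner_add_right inner_diff_left inner_diff_right)
  ultimately have "(norm u)\<^sup>2 \<le> 0" by simp
  then show False using \<open>u \<noteq> 0\<close> by simp
qed

text \<open>Minimise the gap minus \<open>z \<bullet> (y - x)\<close> over the compact section. The
  value at \<open>x\<close> is 0, so the minimiser has gap at most \<open>h / 2\<close> and is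
  interior; its first-order condition is the claim. Thus \<open>p + x\<close> plus
  \<open>h / 2\<close> times the polar of the section about \<open>x\<close> lies in the image of
  the section under \<open>I + \<partial>v\<close>.\<close>

lemma subgradient_in_strong_section:
  fixes v :: "'a::euclidean_space \<Rightarrow> real"
  assumes cvx: "convex_on B1 v" and x: "x \<in> B1" and p: "subgradient_at v x p"
    and "h > 0" and sub: "cball x (sqrt (2 * h)) \<subseteq> B1"
    and z: "\<And>y. y \<in> strong_section v x p h \<Longrightarrow> z \<bullet> (y - x) \<le> h / 2"
  obtains y where "y \<in> strong_section v x p h" "subgradient_at v y (p + x + z - y)"
proof -
  define T where "T = strong_section v x p h"
  have xT: "x \<in> T" using x \<open>h > 0\<close> by (simp add: T_def strong_section_def)
  have "compact T" unfolding T_def using compact_strong_section[OF cvx p _ sub] \<open>h > 0\<close> by simp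
  moreover have "continuous_on T (\<lambda>y. paraboloid_gap v x p y - z \<bullet> (y - x))"
    by (intro continuous_intros continuous_on_subset[OF continuous_on_paraboloid_gap[OF cvx]])
      (auto simp: T_def strong_section_def)
  ultimately obtain y where y: "y \<in> T" and ymin: "\<And>w. w \<in> T \<Longrightarrow>
      paraboloid_gap v x p y - z \<bullet> (y - x) \<le> paraboloid_gap v x p w - z \<bullet> (w - x)"
    using continuous_attains_inf[of T] xT by blast
  have yB: "y \<in> B1" using y by (simp add: T_def strong_section_def)
  have "paraboloid_gap v x p y \<le> z \<bullet> (y - x)" using ymin[OF xT] by simp
  also have "\<dots> < h" using z[of y] y \<open>h > 0\<close> by (simp add: T_def)
  finally obtain e where e: "e > 0" "ball y e \<subseteq> T"
    unfolding T_def using strong_section_neighbourhood[OF cvx yB] by blast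
  have "subgradient_at v y (p + x + z - y)"
  proof (rule subgradient_if_locally_up_to_quadratic[OF cvx yB e(1)])
    fix w assume "dist y w < e"
    then have "w \<in> T" using e(2) by auto
    from ymin[OF this]
    have "v y - p \<bullet> (y - x) + (norm (y - x))\<^sup>2 / 2 - z \<bullet> (y - x) \<le> v w - p \<bullet> (w - x) + (norm (w - x))\<^sup>2 / 2 - z \<bullet> (w - x)"
      by (simp add: paraboloid_gap_def)
    moreover have "(norm (w - x))\<^sup>2 = (norm (y - x))\<^sup>2 + 2 * ((y - x) \<bullet> (w - y)) + (norm (w - y))\<^sup>2"
      unfolding power2_norm_eq_inner
      by (simp add: inner_diff_left inner_diff_right inner_commute algebra_simps)
    ultimately show "v w \<ge> v y + (p + x + z - y) \<bullet> (w - y) - (norm (w - y))\<^sup>2 / 2"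
      by (simp add: inner_diff_left inner_diff_right inner_add_left field_simps)
  qed
  then show ?thesis using that y by (simp add: T_def)
qed

section \<open>Null sets of Hausdorff measure\<close>

lemma hausdorff_pre_le:
  assumes "A \<subseteq> (\<Union>j. C j)" "\<And>j. bounded (C j)" "\<And>j. diameter (C j) \<le> \<delta>"
  shows "hausdorff_pre s \<delta> A \<le> (\<Sum>j. ennreal (if C j = {} then 0
                 else pi powr (real s / 2) / Gamma (real s / 2 + 1) * (diameter (C j) / 2) ^ s))"
  unfolding hausdorff_pre_def using assms by (intro INF_lower) auto

lemma hausdorff_pre_mono:
  assumes "A \<subseteq> B"
  shows "hausdorff_pre s \<delta> A \<le> hausdorff_pre s \<delta> B"
  unfolding hausdorff_pre_def using assms by (intro INF_superset_mono) auto

lemma hausdorff_measure_null_iff: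
  "hausdorff_measure s A = 0 \<longleftrightarrow> (\<forall>\<delta>>0. hausdorff_pre s \<delta> A = 0)"
  unfolding hausdorff_measure_def by (auto simp: bot_ennreal[symmetric] SUP_bot_conv simp del: Sup_bot_conv)

lemma ennreal_eq_0_if_le_all:
  fixes a :: ennreal
  assumes "\<And>e. e > 0 \<Longrightarrow> a \<le> ennreal e"
  shows "a = 0"
  using ennreal_le_epsilon[of 0 a] assms by simp

lemma hausdorff_pre_UN_null:
  fixes A :: "nat \<Rightarrow> 'a::metric_space set"
  assumes null: "\<And>k. hausdorff_pre s \<delta> (A k) = 0"
  shows "hausdorff_pre s \<delta> (\<Union>k. A k) = 0"
proof (rule ennreal_eq_0_if_le_all)
  fix e :: real assume "e > 0"
  define wt where "wt C = ennreal (if C = {} then 0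
     else pi powr (real s / 2) / Gamma (real s / 2 + 1) * (diameter C / 2) ^ s)" for C :: "'a set"
  have "\<exists>C. A k \<subseteq> (\<Union>j. C j) \<and> (\<forall>j. bounded (C j) \<and> diameter (C j) \<le> \<delta>) \<and>
      (\<Sum>j. wt (C j)) < ennreal (e * (1 / 2) ^ Suc k)" for k
  proof -
    have "hausdorff_pre s \<delta> (A k) < ennreal (e * (1 / 2) ^ Suc k)"
      unfolding null using \<open>e > 0\<close> by simp
    then show ?thesis
      unfolding hausdorff_pre_def INF_less_iff wt_def by blast
  qed
  then obtain C where C: "\<And>k. A k \<subseteq> (\<Union>j. C k j)" "\<And>k j. bounded (C k j)" "\<And>k j. diameter (C k j) \<le> \<delta>"
      and sumC: "\<And>k. (\<Sum>j. wt (C k j)) < ennreal (e * (1 / 2) ^ Suc k)"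
    by metis
  define D where "D i = (case prod_decode i of (k, j) \<Rightarrow> C k j)" for i
  have "hausdorff_pre s \<delta> (\<Union>k. A k) \<le> (\<Sum>i. wt (D i))"
    unfolding wt_def
  proof (rule hausdorff_pre_le)
    show "(\<Union>k. A k) \<subseteq> (\<Union>i. D i)"
    proof
      fix x assume "x \<in> (\<Union>k. A k)"
      then obtain k j where "x \<in> C k j" using C(1) by blast
      then have "x \<in> D (prod_encode (k, j))" by (simp add: D_def)
      then show "x \<in> (\<Union>i. D i)" by blast
    qed
  qed (auto simp: D_def C split: prod.splits)
  also have "\<dots> = (\<Sum>i. (\<lambda>(k, j). wt (C k j)) (prod_decode i))"
    by (intro suminf_cong) (auto simp: D_def split: prod.splits)
  also have "\<dots> = (\<Sum>k. \<Sum>j. wt (C k j))"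
    by (rule suminf_ennreal_2dimen) simp
  also have "\<dots> \<le> (\<Sum>k. ennreal (e * (1 / 2) ^ Suc k))"
    using sumC by (intro suminf_le) (auto simp: less_imp_le)
  also have "\<dots> = ennreal (\<Sum>k. e * (1 / 2) ^ Suc k)"
  proof (rule suminf_ennreal2)
    show "summable (\<lambda>k. e * (1 / 2) ^ Suc k)"
      using sums_mult[OF power_half_series, of e] by (rule sums_summable)
  qed (use \<open>e > 0\<close> in auto)
  also have "(\<Sum>k. e * (1 / 2) ^ Suc k) = e"
    using sums_mult[OF power_half_series, of e] by (simp add: sums_iff)
  finally show "hausdorff_pre s \<delta> (\<Union>k. A k) \<le> ennreal e" .
qed

lemma hausdorff_measure_UN_null:
  fixes A :: "nat \<Rightarrow> 'a::metric_space set"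
  assumes "\<And>k. hausdorff_measure s (A k) = 0"
  shows "hausdorff_measure s (\<Union>k. A k) = 0"
  using assms hausdorff_pre_UN_null[of s _ A] by (simp add: hausdorff_measure_null_iff)

lemma hausdorff_measure_null_subset:
  assumes "hausdorff_measure s B = 0" "A \<subseteq> B"
  shows "hausdorff_measure s A = 0"
  using assms hausdorff_pre_mono[OF assms(2), of s] by (simp add: hausdorff_measure_null_iff)
    (metis le_zero_eq)

section \<open>Coverings charged to a measure\<close>

lemma hausdorff_pre_le_vitali:
  fixes M :: "'a::euclidean_space measure"
  assumes M: "sets M = sets borel" and W: "W \<in> sets borel" and \<Lambda>: "\<Lambda> > 0" and "\<delta> > 0"
    and dens: "\<And>x. x \<in> A \<Longrightarrow> \<exists>r. 0 < r \<and> r \<le> \<delta> \<and> ennreal (\<Lambda> * r ^ s) \<le> emeasure M (cball x r \<inter> W)"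
  shows "hausdorff_pre s (10 * \<delta>) A \<le>
    ennreal (pi powr (real s / 2) / Gamma (real s / 2 + 1) * 5 ^ s / \<Lambda>) * emeasure M W"
proof -
  define w where "w = pi powr (real s / 2) / Gamma (real s / 2 + 1)"
  have "w > 0" unfolding w_def by (auto intro!: divide_pos_pos Gamma_real_pos add_nonneg_pos)
  obtain r where r: "\<And>x. x \<in> A \<Longrightarrow> 0 < r x" "\<And>x. x \<in> A \<Longrightarrow> r x \<le> \<delta>"
      "\<And>x. x \<in> A \<Longrightarrow> ennreal (\<Lambda> * r x ^ s) \<le> emeasure M (cball x (r x) \<inter> W)"
    using dens by metis
  have "A \<subseteq> (\<Union>x\<in>A. cball x (r x))" using r(1) by (force simp: less_imp_le)
  \<comment> \<open>The disjoint balls are charged to the parts of \<open>W\<close> inside them; the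
    fivefold balls cover \<open>A\<close> and have diameter at most \<open>10 * \<delta>\<close>,
    whence the factor \<open>5 ^ s\<close>.\<close>
  then obtain C where C: "countable C" "C \<subseteq> A"
     "pairwise (\<lambda>i j. disjnt (cball i (r i)) (cball j (r j))) C"
     "A \<subseteq> (\<Union>i\<in>C. cball i (5 * r i))"
    by (rule Vitali_covering_lemma_cballs[where r=r and B=\<delta>]) (use r(1,2) in auto)
  define N where "N = to_nat_on C ` C"
  define g where "g = inv_into C (to_nat_on C)"
  have inj: "inj_on (to_nat_on C) C" using C(1) by (rule inj_on_to_nat_on)
  have gC: "g j \<in> C" if "j \<in> N" for j
    using that unfolding g_def N_def by (rule inv_into_into)
  have ginj: "i = j" if "i \<in> N" "j \<in> N" "g i = g j" for i j
    using that unfolding g_def N_def by (metis f_inv_into_f)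
  \<comment> \<open>Indices outside \<open>N\<close> get the empty set, which costs 0 by convention;
    for \<open>s = 0\<close> even a set of diameter 0 would have positive cost.\<close>
  define D where "D j = (if j \<in> N then cball (g j) (5 * r (g j)) else {})" for j
  define E where "E j = (if j \<in> N then cball (g j) (r (g j)) \<inter> W else {})" for j
  have rg: "0 < r (g j)" "r (g j) \<le> \<delta>" if "j \<in> N" for j
    using r gC[OF that] C(2) by auto
  have "hausdorff_pre s (10 * \<delta>) A \<le> (\<Sum>j. ennreal (if D j = {} then 0
                 else pi powr (real s / 2) / Gamma (real s / 2 + 1) * (diameter (D j) / 2) ^ s))"
  proof (rule hausdorff_pre_le)
    show "A \<subseteq> (\<Union>j. D j)"
    proof
      fix x assume "x \<in> A"
      then obtain y where y: "y \<in> C" "x \<in> cball y (5 * r y)" using C(4) by blast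
      then have "to_nat_on C y \<in> N" "g (to_nat_on C y) = y"
        using inj by (auto simp: N_def g_def)
      then have "x \<in> D (to_nat_on C y)" using y by (simp add: D_def)
      then show "x \<in> (\<Union>j. D j)" by blast
    qed
    show "bounded (D j)" for j by (simp add: D_def)
    show "diameter (D j) \<le> 10 * \<delta>" for j
      using rg[of j] \<open>\<delta> > 0\<close> by (auto simp: D_def diameter_cball)
  qed
  also have "\<dots> \<le> (\<Sum>j. ennreal (w * 5 ^ s / \<Lambda>) * emeasure M (E j))"
  proof (intro suminf_le allI)
    fix j
    show "ennreal (if D j = {} then 0 else pi powr (real s / 2) / Gamma (real s / 2 + 1) * (diameter (D j) / 2) ^ s)
       \<le> ennreal (w * 5 ^ s / \<Lambda>) * emeasure M (E j)"
    proof (cases "j \<in> N")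
      case True
      have "ennreal (if D j = {} then 0 else w * (diameter (D j) / 2) ^ s) = ennreal (w * (5 * r (g j)) ^ s)"
        using True rg[OF True] by (auto simp: D_def diameter_cball)
      also have "\<dots> = ennreal (w * 5 ^ s / \<Lambda>) * ennreal (\<Lambda> * r (g j) ^ s)"
        using \<Lambda> \<open>w > 0\<close> by (subst ennreal_mult'[symmetric]) (auto simp: power_mult_distrib)
      also have "\<dots> \<le> ennreal (w * 5 ^ s / \<Lambda>) * emeasure M (E j)"
        using True r(3) gC[OF True] C(2) by (intro mult_left_mono) (auto simp: E_def)
      finally show ?thesis unfolding w_def .
    qed (simp add: D_def)
  qed auto
  also have "\<dots> = ennreal (w * 5 ^ s / \<Lambda>) * (\<Sum>j. emeasure M (E j))"
    by (rule ennreal_suminf_cmult)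
  also have "(\<Sum>j. emeasure M (E j)) = emeasure M (\<Union>j. E j)"
  proof (rule suminf_emeasure)
    show "range E \<subseteq> sets M" using W by (auto simp: M E_def)
    show "disjoint_family E"
      unfolding disjoint_family_on_def
    proof (intro ballI impI)
      fix i j :: nat assume "i \<noteq> j"
      show "E i \<inter> E j = {}"
      proof (cases "i \<in> N \<and> j \<in> N")
        case True
        then have "g i \<noteq> g j" using ginj \<open>i \<noteq> j\<close> by blast
        then have "disjnt (cball (g i) (r (g i))) (cball (g j) (r (g j)))"
          using True C(3) gC by (simp add: pairwise_def)
        then show ?thesis by (auto simp: E_def disjnt_def)
      qed (auto simp: E_def)
    qed
  qed
  also have "emeasure M (\<Union>j. E j) \<le> emeasure M W"
    using W by (intro emeasure_mono) (auto simp: M E_def)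
  finally show ?thesis unfolding w_def by (simp add: mult_left_mono)
qed

text \<open>The covering bound with \<open>\<Lambda> = Suc j\<close> is a constant times the total
  mass divided by \<open>Suc j\<close>, hence arbitrarily small.\<close>

lemma hausdorff_measure_null_infinite_density:
  fixes M :: "'a::euclidean_space measure"
  assumes M: "sets M = sets borel" "emeasure M (space M) \<noteq> \<infinity>"
    and dens: "\<And>x j. x \<in> A \<Longrightarrow> \<exists>r. 0 < r \<and> r < 1 / real (Suc j) \<and> ennreal (real (Suc j) * r ^ s) \<le> emeasure M (cball x r)"
  shows "hausdorff_measure s A = 0"
  unfolding hausdorff_measure_null_iff
proof (intro allI impI ennreal_eq_0_if_le_all)
  fix \<delta> e :: real assume "\<delta> > 0" "e > 0"
  define w where "w = pi powr (real s / 2) / Gamma (real s / 2 + 1) * 5 ^ s"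
  have "w > 0" unfolding w_def by (auto intro!: divide_pos_pos Gamma_real_pos add_nonneg_pos mult_pos_pos)
  define m where "m = measure M UNIV"
  have spM: "space M = UNIV" using sets_eq_imp_space_eq[OF M(1)] by simp
  have m: "emeasure M UNIV = ennreal m" "0 \<le> m"
    using M(2) by (auto simp: m_def spM emeasure_eq_ennreal_measure)
  obtain j :: nat where j: "real j > max (10 / \<delta>) (w * m / e)" using reals_Archimedean2 by blast
  have "1 / Suc j \<le> \<delta> / 10"
  proof -
    have "10 / \<delta> < real (Suc j)" using j by simp
    then show ?thesis using \<open>\<delta> > 0\<close> by (simp add: field_simps)
  qed
  have "hausdorff_pre s (10 * (\<delta> / 10)) A \<le> ennreal (w / Suc j) * emeasure M UNIV"
    unfolding w_def
  proof (rule hausdorff_pre_le_vitali[OF M(1)])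
    fix x assume "x \<in> A"
    then obtain r where "0 < r" "r < 1 / real (Suc j)" "ennreal (real (Suc j) * r ^ s) \<le> emeasure M (cball x r)"
      using dens by blast
    then show "\<exists>r>0. r \<le> \<delta> / 10 \<and> ennreal (real (Suc j) * r ^ s) \<le> emeasure M (cball x r \<inter> UNIV)"
      using \<open>1 / Suc j \<le> \<delta> / 10\<close> by (intro exI[of _ r]) auto
  qed (use \<open>\<delta> > 0\<close> in auto)
  also have "\<dots> = ennreal (w / Suc j * m)"
    using m \<open>w > 0\<close> by (simp add: ennreal_mult'[symmetric])
  also have "\<dots> \<le> ennreal e"
  proof (rule ennreal_leI)
    have "w * m / e < real (Suc j)" using j by simp
    then show "w / Suc j * m \<le> e" using \<open>e > 0\<close> by (simp add: field_simps)
  qed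
  finally show "hausdorff_pre s \<delta> A \<le> ennreal e" by simp
qed

text \<open>The hypothesis says that a definite portion of the mass near \<open>x\<close> sits in sets \<open>K\<close> of small
  \<open>s\<close>-dimensional content. Where the upper density is finite, such a \<open>K\<close> mostly misses the closure
  \<open>F\<close> of \<open>A\<close>, so that a Vitali cover of \<open>A\<close> is charged to the mass of \<open>U - F\<close> for open \<open>U \<supseteq> F\<close>.\<close>

lemma hausdorff_measure_null_finite_density:
  fixes M :: "'a::euclidean_space measure" and b c :: real
  assumes M: "sets M = sets borel" "emeasure M (space M) \<noteq> \<infinity>"
    and c: "c > 0" and b: "b > 0" and R: "R > 0"
    and upper: "\<And>x r. x \<in> A \<Longrightarrow> 0 < r \<Longrightarrow> r < R \<Longrightarrow> emeasure M (cball x r) \<le> ennreal (b * r ^ s)"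
    and thin: "\<And>x \<eta> \<delta>. x \<in> A \<Longrightarrow> \<eta> > 0 \<Longrightarrow> \<delta> > 0 \<Longrightarrow>
      \<exists>r K Z \<rho>. 0 < r \<and> r < \<delta> \<and> K \<in> sets borel \<and> K \<subseteq> cball x r \<and> finite Z \<and>
        K \<subseteq> (\<Union>z\<in>Z. cball z \<rho>) \<and> 0 < \<rho> \<and> \<rho> \<le> r \<and> real (card Z) * \<rho> ^ s \<le> \<eta> * r ^ s \<and>
        ennreal (c * r ^ s) \<le> emeasure M K"
  shows "hausdorff_measure s A = 0"
  unfolding hausdorff_measure_null_iff
proof (intro allI impI ennreal_eq_0_if_le_all)
  fix \<delta> e :: real assume "\<delta> > 0" "e > 0"
  define w where "w = pi powr (real s / 2) / Gamma (real s / 2 + 1) * 5 ^ s"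
  have "w > 0" unfolding w_def by (auto intro!: divide_pos_pos Gamma_real_pos add_nonneg_pos mult_pos_pos)
  interpret finite_measure M by (rule finite_measureI) (use M(2) in simp)
  have spM: "space M = UNIV" using sets_eq_imp_space_eq[OF M(1)] by simp
  define F where "F = closure A"
  have Fs: "F \<in> sets borel" unfolding F_def by simp
  \<comment> \<open>This is the constant of the covering bound for density \<open>c / 2\<close>:
    half of the mass in \<open>K\<close> will be shown to lie outside \<open>F\<close>.\<close>
  define k where "k = w / (c / 2)"
  have "k > 0" using \<open>w > 0\<close> c by (simp add: k_def)
  have "\<exists>U. F \<subseteq> U \<and> open U \<and> emeasure M U < emeasure M F + ennreal (e / k)"
  proof -
    have "emeasure M F < emeasure M F + ennreal (e / k)"
      using \<open>e > 0\<close> \<open>k > 0\<close>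
      by (simp add: emeasure_eq_measure ennreal_plus[symmetric] ennreal_less_iff del: ennreal_plus)
    then have "(INF U\<in>{U. F \<subseteq> U \<and> open U}. emeasure M U) < emeasure M F + ennreal (e / k)"
      using outer_regular[OF M(1,2) Fs] by simp
    then show ?thesis unfolding INF_less_iff by blast
  qed
  then obtain U where U: "F \<subseteq> U" "open U" "emeasure M U < emeasure M F + ennreal (e / k)" by blast
  have UF: "emeasure M (U - F) \<le> ennreal (e / k)"
  proof -
    have "emeasure M F + emeasure M (U - F) = emeasure M U"
      using U(1,2) Fs by (subst plus_emeasure) (auto simp: M(1) intro!: arg_cong[where f="emeasure M"])
    then have "emeasure M F + emeasure M (U - F) \<le> emeasure M F + ennreal (e / k)"
      using U(3) by simp
    then show ?thesis
      using emeasure_finite[of F] by (subst (asm) ennreal_add_left_cancel_le) auto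
  qed
  have "hausdorff_pre s (10 * (\<delta> / 10)) A \<le> ennreal (w / (c / 2)) * emeasure M (U - F)"
    unfolding w_def
  proof (rule hausdorff_pre_le_vitali[OF M(1)])
    show "U - F \<in> sets borel" using U(2) Fs by auto
    fix x assume x: "x \<in> A"
    then have "x \<in> U" using U(1) closure_subset unfolding F_def by blast
    then obtain \<epsilon> where \<epsilon>: "\<epsilon> > 0" "cball x \<epsilon> \<subseteq> U" using U(2) open_contains_cball by blast
    \<comment> \<open>With this \<open>\<eta>\<close>, the balls covering \<open>K\<close>, each
      carrying at most \<open>b * (3 * \<rho>) ^ s\<close> on \<open>F\<close>, leave
      \<open>F\<close> at most half of \<open>c * r ^ s\<close>. The bound \<open>R / 3\<close>
      below keeps \<open>3 * \<rho>\<close> under \<open>R\<close>.\<close>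
    define \<eta> where "\<eta> = c / (2 * b * 3 ^ s)"
    have "\<eta> > 0" using c b by (simp add: \<eta>_def)
    have "0 < min \<epsilon> (min (\<delta> / 10) (R / 3))" using \<epsilon>(1) \<open>\<delta> > 0\<close> R by simp
    obtain r K Z \<rho> where r: "0 < r" "r < min \<epsilon> (min (\<delta> / 10) (R / 3))"
      and K: "K \<in> sets borel" "K \<subseteq> cball x r"
      and Z: "finite Z" "K \<subseteq> (\<Union>z\<in>Z. cball z \<rho>)"
      and \<rho>: "0 < \<rho>" "\<rho> \<le> r" "real (card Z) * \<rho> ^ s \<le> \<eta> * r ^ s"
      and cK: "ennreal (c * r ^ s) \<le> emeasure M K"
      using thin[OF x \<open>\<eta> > 0\<close> \<open>0 < min \<epsilon> (min (\<delta> / 10) (R / 3))\<close>] by (elim exE conjE) (rule that)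
    have small: "emeasure M (cball z \<rho> \<inter> F) \<le> ennreal (b * (3 * \<rho>) ^ s)" for z
    proof (cases "cball z \<rho> \<inter> F = {}")
      case False
      then obtain p where p: "p \<in> cball z \<rho>" "p \<in> F" by blast
      \<comment> \<open>The upper density bound is available only at centres in \<open>A\<close>, so
        the ball is recentred at a nearby \<open>a\<close>, which triples the radius.\<close>
      then obtain a where a: "a \<in> A" "dist a p < \<rho>"
        unfolding F_def closure_approachable using \<rho>(1) by blast
      have "cball z \<rho> \<subseteq> cball a (3 * \<rho>)"
      proof
        fix q assume "q \<in> cball z \<rho>"
        then show "q \<in> cball a (3 * \<rho>)"
          using p(1) a(2) dist_triangle[of a q p] dist_triangle[of p q z]
          by (simp add: dist_commute)
      qed
      then have "emeasure M (cball z \<rho> \<inter> F) \<le> emeasure M (cball a (3 * \<rho>))"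
        by (intro emeasure_mono) (auto simp: M(1))
      also have "\<dots> \<le> ennreal (b * (3 * \<rho>) ^ s)"
        by (rule upper[OF a(1)]) (use \<rho>(1,2) r in auto)
      finally show ?thesis .
    qed simp
    have "(\<Union>z\<in>Z. cball z \<rho> \<inter> F) \<in> sets M"
      using Z(1) Fs by (intro sets.finite_UN) (auto simp: M(1))
    then have "emeasure M (K \<inter> F) \<le> emeasure M (\<Union>z\<in>Z. cball z \<rho> \<inter> F)"
      using Z(2) by (intro emeasure_mono) auto
    also have "\<dots> \<le> (\<Sum>z\<in>Z. emeasure M (cball z \<rho> \<inter> F))"
      using Z(1) Fs by (intro emeasure_subadditive_finite) (auto simp: M(1))
    also have "\<dots> \<le> (\<Sum>z\<in>Z. ennreal (b * (3 * \<rho>) ^ s))"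
      by (intro sum_mono small)
    also have "\<dots> = ennreal (b * 3 ^ s * (real (card Z) * \<rho> ^ s))"
      using b \<rho>(1) by (simp add: ennreal_of_nat_eq_real_of_nat ennreal_mult'[symmetric] power_mult_distrib ac_simps)
    also have "\<dots> \<le> ennreal (b * 3 ^ s * (\<eta> * r ^ s))"
      using \<rho>(3) b by (intro ennreal_leI mult_left_mono) auto
    also have "b * 3 ^ s * (\<eta> * r ^ s) = c / 2 * r ^ s"
      using b by (simp add: \<eta>_def field_simps)
    finally have KF: "emeasure M (K \<inter> F) \<le> ennreal (c / 2 * r ^ s)" .
    have "ennreal (c / 2 * r ^ s) + ennreal (c / 2 * r ^ s) = ennreal (c * r ^ s)"
      using c r(1) by (subst ennreal_plus[symmetric]) (auto simp: field_simps)
    also have "\<dots> \<le> emeasure M ((K \<inter> F) \<union> (K - F))"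
      using cK by (simp add: Int_Diff_Un)
    also have "\<dots> \<le> emeasure M (K \<inter> F) + emeasure M (K - F)"
      using K(1) Fs by (intro emeasure_subadditive) (auto simp: M(1))
    also have "\<dots> \<le> ennreal (c / 2 * r ^ s) + emeasure M (K - F)"
      using KF by (intro add_mono) auto
    finally have "ennreal (c / 2 * r ^ s) \<le> emeasure M (K - F)"
      by (simp add: ennreal_add_left_cancel_le)
    also have "\<dots> \<le> emeasure M (cball x r \<inter> (U - F))"
    proof (rule emeasure_mono)
      have "cball x r \<subseteq> cball x \<epsilon>" using r(2) by (intro subset_cball) simp
      then show "K - F \<subseteq> cball x r \<inter> (U - F)" using K(2) \<epsilon>(2) by blast
      show "cball x r \<inter> (U - F) \<in> sets M" using U(2) Fs by (auto simp: M(1))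
    qed
    finally show "\<exists>r>0. r \<le> \<delta> / 10 \<and> ennreal (c / 2 * r ^ s) \<le> emeasure M (cball x r \<inter> (U - F))"
      using r by (intro exI[of _ r]) auto
  qed (use \<open>\<delta> > 0\<close> c in auto)
  also have "\<dots> \<le> ennreal k * ennreal (e / k)"
    unfolding k_def[symmetric] by (intro mult_left_mono UF) auto
  also have "\<dots> = ennreal e"
    using \<open>k > 0\<close> \<open>e > 0\<close> by (subst ennreal_mult'[symmetric]) auto
  finally show "hausdorff_pre s \<delta> A \<le> ennreal e" by simp
qed

text \<open>The finite-density criterion needs uniform constants, so \<open>A\<close> is cut into
  countably many pieces. A point outside the infinite-density part \<open>B\<close> fails its
  condition for some \<open>j\<close>, and this one \<open>j\<close> supplies both the density bound
  and the radius below which it holds.\<close>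

lemma hausdorff_measure_null_thin:
  fixes M :: "'a::euclidean_space measure"
  assumes M: "sets M = sets borel" "emeasure M (space M) \<noteq> \<infinity>"
    and thin: "\<And>x. x \<in> A \<Longrightarrow> \<exists>c>0. \<forall>\<eta>>0. \<forall>\<delta>>0.
      \<exists>r K Z \<rho>. 0 < r \<and> r < \<delta> \<and> K \<in> sets borel \<and> K \<subseteq> cball x r \<and> finite Z \<and>
        K \<subseteq> (\<Union>z\<in>Z. cball z \<rho>) \<and> 0 < \<rho> \<and> \<rho> \<le> r \<and> real (card Z) * \<rho> ^ s \<le> \<eta> * r ^ s \<and>
        ennreal (c * r ^ s) \<le> emeasure M K"
  shows "hausdorff_measure s A = 0"
proof -
  define P where "P x c \<eta> \<delta> \<longleftrightarrow> (\<exists>r K Z \<rho>. 0 < r \<and> r < \<delta> \<and> K \<in> sets borel \<and> K \<subseteq> cball x r \<and> finite Z \<and>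
        K \<subseteq> (\<Union>z\<in>Z. cball z \<rho>) \<and> 0 < \<rho> \<and> \<rho> \<le> r \<and> real (card Z) * \<rho> ^ s \<le> \<eta> * r ^ s \<and>
        ennreal (c * r ^ s) \<le> emeasure M K)" for x and c \<eta> \<delta> :: real
  define B where "B = {x \<in> A. \<forall>j. \<exists>r. 0 < r \<and> r < 1 / real (Suc j) \<and> ennreal (real (Suc j) * r ^ s) \<le> emeasure M (cball x r)}"
  define E where "E i j = {x \<in> A. (\<forall>\<eta>>0. \<forall>\<delta>>0. P x (1 / Suc i) \<eta> \<delta>) \<and>
    (\<forall>r. 0 < r \<longrightarrow> r < 1 / real (Suc j) \<longrightarrow> emeasure M (cball x r) \<le> ennreal (real (Suc j) * r ^ s))}" for i j :: nat
  have B0: "hausdorff_measure s B = 0"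
    using M by (rule hausdorff_measure_null_infinite_density) (auto simp: B_def)
  have E0: "hausdorff_measure s (E i j) = 0" for i j
  proof (rule hausdorff_measure_null_finite_density[OF M, where c="1 / Suc i" and b="Suc j" and R="1 / Suc j"])
    show "emeasure M (cball x r) \<le> ennreal (real (Suc j) * r ^ s)"
      if "x \<in> E i j" "0 < r" "r < 1 / real (Suc j)" for x r
      using that unfolding E_def by blast
    fix x and \<eta> \<delta> :: real assume "x \<in> E i j" "\<eta> > 0" "\<delta> > 0"
    then have "P x (1 / Suc i) \<eta> \<delta>" unfolding E_def by blast
    then show "\<exists>r K Z \<rho>. 0 < r \<and> r < \<delta> \<and> K \<in> sets borel \<and> K \<subseteq> cball x r \<and> finite Z \<and>
        K \<subseteq> (\<Union>z\<in>Z. cball z \<rho>) \<and> 0 < \<rho> \<and> \<rho> \<le> r \<and> real (card Z) * \<rho> ^ s \<le> \<eta> * r ^ s \<and>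
        ennreal (1 / real (Suc i) * r ^ s) \<le> emeasure M K"
      unfolding P_def .
  qed auto
  define G where "G k = (if k = 0 then B else case prod_decode (k - 1) of (i, j) \<Rightarrow> E i j)" for k
  have "hausdorff_measure s (\<Union>k. G k) = 0"
    by (rule hausdorff_measure_UN_null) (auto simp: G_def B0 E0 split: prod.split)
  moreover have "A \<subseteq> (\<Union>k. G k)"
  proof
    fix x assume x: "x \<in> A"
    show "x \<in> (\<Union>k. G k)"
    proof (cases "x \<in> B")
      case True
      then have "x \<in> G 0" by (simp add: G_def)
      then show ?thesis by blast
    next
      case False
      then obtain j where j: "\<And>r. 0 < r \<Longrightarrow> r < 1 / real (Suc j) \<Longrightarrow> \<not> ennreal (real (Suc j) * r ^ s) \<le> emeasure M (cball x r)"
        using x unfolding B_def by blast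
      obtain c where c: "c > 0" "\<And>\<eta> \<delta>. \<eta> > 0 \<Longrightarrow> \<delta> > 0 \<Longrightarrow> P x c \<eta> \<delta>"
        using thin[OF x] unfolding P_def[symmetric] by blast
      obtain i :: nat where i: "1 / Suc i < c" using c(1) nat_approx_posE by blast
      have "P x (1 / Suc i) \<eta> \<delta>" if pos: "\<eta> > 0" "\<delta> > 0" for \<eta> \<delta>
      proof -
        have le: "ennreal (1 / Suc i * r ^ s) \<le> ennreal (c * r ^ s)" if "0 < r" for r
          using i that by (intro ennreal_leI mult_right_mono) auto
        from c(2)[OF pos] obtain r K Z \<rho> where *: "0 < r" "r < \<delta>" "K \<in> sets borel" "K \<subseteq> cball x r"
          "finite Z" "K \<subseteq> (\<Union>z\<in>Z. cball z \<rho>)" "0 < \<rho>" "\<rho> \<le> r"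
          "real (card Z) * \<rho> ^ s \<le> \<eta> * r ^ s" "ennreal (c * r ^ s) \<le> emeasure M K"
          unfolding P_def by (elim exE conjE) (rule that)
        with order_trans[OF le[OF *(1)] *(10)] show ?thesis
          unfolding P_def by (intro exI conjI)
      qed
      then have "x \<in> E i j"
        using x j unfolding E_def by (auto simp: not_le intro: less_imp_le)
      then have "x \<in> G (Suc (prod_encode (i, j)))" by (simp add: G_def)
      then show ?thesis by blast
    qed
  qed
  ultimately show ?thesis by (rule hausdorff_measure_null_subset)
qed

section \<open>The resolvent measure and thin sections\<close>

text \<open>The measure is the push-forward of Lebesgue measure by the resolvent \<open>(I + \<partial>v)\<^sup>-\<^sup>1\<close>, that is the
  Monge-Ampere measure of \<open>v + |x|\<^sup>2/2\<close> restricted to the closed ball of radius \<open>R\<close>.\<close>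

lemma resolvent_measure:
  fixes v :: "'a::euclidean_space \<Rightarrow> real"
  assumes cvx: "convex_on B1 v" and R: "R < 1"
  obtains M :: "'a measure" where "sets M = sets borel" "emeasure M (space M) \<noteq> \<infinity>"
    "\<And>T Q. T \<in> sets borel \<Longrightarrow> (\<And>q. q \<in> Q \<Longrightarrow> \<exists>y\<in>T \<inter> cball 0 R. subgradient_at v y (q - y)) \<Longrightarrow>
      emeasure lborel Q \<le> emeasure M T"
proof -
  define D where "D = {q. \<exists>x\<in>cball 0 R. subgradient_at v x (q - x)}"
  have "D = (\<lambda>(x, p). x + p) ` {(x, p). x \<in> cball 0 R \<and> subgradient_at v x p}"
  proof (intro set_eqI iffI)
    fix q assume "q \<in> D"
    then obtain x where "x \<in> cball 0 R" "subgradient_at v x (q - x)" by (auto simp: D_def)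
    then show "q \<in> (\<lambda>(x, p). x + p) ` {(x, p). x \<in> cball 0 R \<and> subgradient_at v x p}"
      by (intro image_eqI[of _ _ "(x, q - x)"]) auto
  next
    fix q assume "q \<in> (\<lambda>(x, p). x + p) ` {(x, p). x \<in> cball 0 R \<and> subgradient_at v x p}"
    then obtain x p where "q = x + p" "x \<in> cball 0 R" "subgradient_at v x p" by auto
    then show "q \<in> D" unfolding D_def by (intro CollectI bexI[of _ x]) auto
  qed
  moreover have "compact ((\<lambda>(x, p). x + p) ` {(x, p). x \<in> cball 0 R \<and> subgradient_at v x p})"
    using compact_subgradient_graph[OF assms]
    by (rule compact_continuous_image[rotated]) (unfold split_def, intro continuous_intros)
  ultimately have "compact D" by simp
  then have Ds: "D \<in> sets lborel" by (simp add: borel_compact)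
  have BR: "y \<in> B1" if "y \<in> cball 0 R" for y :: 'a using that R by auto
  \<comment> \<open>Monotonicity of \<open>\<partial>v\<close> makes \<open>I + \<partial>v\<close>
    expanding. Hence the selection \<open>G\<close> below is 1-Lipschitz, and the case
    \<open>q = q'\<close> identifies every solution \<open>y\<close> with
    \<open>G q\<close>.\<close>
  have mono: "norm (x - y) \<le> norm (q - q')"
    if xy: "x \<in> cball 0 R" "y \<in> cball 0 R" and sg: "subgradient_at v x (q - x)" "subgradient_at v y (q' - y)" for x y q q'
  proof -
    have "v y \<ge> v x + (q - x) \<bullet> (y - x)" "v x \<ge> v y + (q' - y) \<bullet> (x - y)"
      using sg xy BR unfolding subgradient_at_def by blast+
    then have "(q - x) \<bullet> (y - x) + (q' - y) \<bullet> (x - y) \<le> 0" by linarith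
    then have "(x - y) \<bullet> (x - y) \<le> (q - q') \<bullet> (x - y)"
      by (simp add: inner_diff_left inner_diff_right inner_commute algebra_simps)
    also have "\<dots> \<le> norm (q - q') * norm (x - y)" by (rule norm_cauchy_schwarz)
    finally have "norm (x - y) * norm (x - y) \<le> norm (q - q') * norm (x - y)"
      by (simp add: dot_square_norm power2_eq_square)
    then show ?thesis
      by (cases "x = y") (auto simp: mult_le_cancel_right)
  qed
  have "\<forall>q\<in>D. \<exists>x. x \<in> cball 0 R \<and> subgradient_at v x (q - x)" unfolding D_def by blast
  then obtain G where G: "\<And>q. q \<in> D \<Longrightarrow> G q \<in> cball 0 R" "\<And>q. q \<in> D \<Longrightarrow> subgradient_at v (G q) (q - G q)"
    using bchoice[of D "\<lambda>q x. x \<in> cball 0 R \<and> subgradient_at v x (q - x)"] by blast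
  have "continuous_on D G"
    unfolding continuous_on_iff
  proof (intro ballI allI impI)
    fix q e assume q: "q \<in> D" and e: "(0::real) < e"
    have "dist (G q') (G q) \<le> dist q' q" if "q' \<in> D" for q'
      unfolding dist_norm by (rule mono) (use G q that in blast)+
    then show "\<exists>d>0. \<forall>q'\<in>D. dist q' q < d \<longrightarrow> dist (G q') (G q) < e"
      using e le_less_trans by blast
  qed
  then have Gm: "G \<in> measurable (restrict_space lborel D) borel"
    using borel_measurable_continuous_on_restrict[of D G]
      measurable_cong_sets[of "restrict_space lborel D" "restrict_space borel D" borel borel]
    by (simp add: sets_restrict_space)
  define M where "M = distr (restrict_space lborel D) borel G"
  have eM: "emeasure M T = emeasure lborel (G -` T \<inter> D)" if "T \<in> sets borel" for T
    unfolding M_def using that Ds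
    by (simp add: emeasure_distr[OF Gm] emeasure_restrict_space space_restrict_space)
  have meas: "G -` T \<inter> D \<in> sets lborel" if "T \<in> sets borel" for T
    using measurable_sets[OF Gm that] Ds
    by (simp add: space_restrict_space sets_restrict_space_iff)
  show ?thesis
  proof (rule that)
    show "sets M = sets borel" by (simp add: M_def)
    show "emeasure M (space M) \<noteq> \<infinity>"
    proof -
      have "space M = UNIV" by (simp add: M_def)
      then have "emeasure M (space M) = emeasure lborel D" by (simp add: eM)
      then show ?thesis using emeasure_compact_finite[OF \<open>compact D\<close>] by simp
    qed
    fix T Q assume T: "T \<in> sets borel"
      and Q: "\<And>q. q \<in> Q \<Longrightarrow> \<exists>y\<in>T \<inter> cball 0 R. subgradient_at v y (q - y)"
    have "Q \<subseteq> G -` T \<inter> D"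
    proof
      fix q assume "q \<in> Q"
      then obtain y where y: "y \<in> T" "y \<in> cball 0 R" "subgradient_at v y (q - y)" using Q by blast
      then have "q \<in> D" by (auto simp: D_def)
      moreover have "G q = y"
        using mono[OF G(1)[OF \<open>q \<in> D\<close>] y(2) G(2)[OF \<open>q \<in> D\<close>] y(3)] by simp
      ultimately show "q \<in> G -` T \<inter> D" using y(1) by simp
    qed
    then show "emeasure lborel Q \<le> emeasure M T"
      unfolding eM[OF T] by (rule emeasure_mono) (rule meas[OF T])
  qed
qed

text \<open>Only the \<open>n - 2\<close> directions other than \<open>f1\<close> and
  \<open>f2\<close> need a grid, of spacing \<open>r / m\<close> with \<open>2 * m + 1\<close>
  positions each. Every coordinate is then off by at most \<open>r / m\<close>, and summing over the
  \<open>n\<close> directions gives the radius.\<close>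

lemma thin_box_cover:
  fixes F :: "'a::euclidean_space set" and m :: nat
  assumes F: "finite F" "card F = DIM('a)" "pairwise orthogonal F" "\<And>f. f \<in> F \<Longrightarrow> norm f = 1"
    and f12: "f1 \<in> F" "f2 \<in> F" "f1 \<noteq> f2" and "r > 0" "m > 0"
    and T: "\<And>y f. y \<in> T \<Longrightarrow> f \<in> F \<Longrightarrow> \<bar>(y - x) \<bullet> f\<bar> \<le> r"
      "\<And>y. y \<in> T \<Longrightarrow> \<bar>(y - x) \<bullet> f1\<bar> \<le> r / m" "\<And>y. y \<in> T \<Longrightarrow> \<bar>(y - x) \<bullet> f2\<bar> \<le> r / m"
  obtains Z where "finite Z" "card Z \<le> (2 * m + 1) ^ (DIM('a) - 2)"
    "T \<subseteq> (\<Union>z\<in>Z. cball z (real DIM('a) * r / m))"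
proof -
  define F' where "F' = F - {f1, f2}"
  define ctr where "ctr k = x + (\<Sum>f\<in>F'. (real_of_int (k f) * r / m) *\<^sub>R f)" for k :: "'a \<Rightarrow> int"
  define P where "P = PiE F' (\<lambda>_. {- int m..int m})"
  have finF': "finite F'" using F(1) by (simp add: F'_def)
  have cF': "card F' = DIM('a) - 2" using F(1,2) f12 by (simp add: F'_def card_Diff_subset)
  have finP: "finite P" unfolding P_def using finF' by (intro finite_PiE) auto
  have "card P = (2 * m + 1) ^ (DIM('a) - 2)"
    unfolding P_def using finF' by (simp add: card_PiE cF' nat_add_distrib nat_mult_distrib)
  then have "card (ctr ` P) \<le> (2 * m + 1) ^ (DIM('a) - 2)"
    using card_image_le[OF finP, of ctr] by simp
  moreover have "T \<subseteq> (\<Union>z\<in>ctr ` P. cball z (real DIM('a) * r / m))"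
  proof
    fix y assume y: "y \<in> T"
    define k where "k = restrict (\<lambda>f. \<lfloor>(y - x) \<bullet> f * m / r\<rfloor>) F'"
    have "k \<in> P"
      unfolding P_def k_def
    proof (rule restrict_PiE_iff[THEN iffD2], rule ballI)
      fix f assume "f \<in> F'"
      then have b: "\<bar>(y - x) \<bullet> f\<bar> \<le> r" using T(1)[OF y] by (simp add: F'_def)
      have "(y - x) \<bullet> f * m / r \<le> m" "- real m \<le> (y - x) \<bullet> f * m / r"
        using b \<open>r > 0\<close> \<open>m > 0\<close> mult_right_mono[of "(y - x) \<bullet> f" r m] mult_right_mono[of "- r" "(y - x) \<bullet> f" m]
        by (auto simp: pos_divide_le_eq pos_le_divide_eq abs_le_iff mult.commute)
      then show "\<lfloor>(y - x) \<bullet> f * m / r\<rfloor> \<in> {- int m..int m}"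
        by (auto simp: le_floor_iff floor_le_iff)
    qed
    define c where "c f = (y - x) \<bullet> f - (if f \<in> F' then real_of_int (k f) * r / m else 0)" for f
    have c: "\<bar>c f\<bar> \<le> r / m" if "f \<in> F" for f
    proof (cases "f \<in> F'")
      case True
      define u where "u = (y - x) \<bullet> f * m / r"
      have "(y - x) \<bullet> f = u * (r / m)" using \<open>r > 0\<close> \<open>m > 0\<close> by (simp add: u_def)
      then have "c f = (u - \<lfloor>u\<rfloor>) * (r / m)" using True by (simp add: c_def k_def u_def[symmetric] left_diff_distrib diff_divide_distrib)
      moreover have "\<bar>u - \<lfloor>u\<rfloor>\<bar> \<le> 1" by linarith
      ultimately have "\<bar>c f\<bar> \<le> 1 * (r / m)"
        using \<open>r > 0\<close> by (simp add: abs_mult mult_left_le_one_le divide_right_mono)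
      then show ?thesis by simp
    next
      case False
      then have "f = f1 \<or> f = f2" using that by (simp add: F'_def)
      then show ?thesis using False T(2,3)[OF y] by (auto simp: c_def)
    qed
    have "y - ctr k = (\<Sum>f\<in>F. ((y - x) \<bullet> f) *\<^sub>R f) - (\<Sum>f\<in>F'. (real_of_int (k f) * r / m) *\<^sub>R f)"
      by (simp add: orthonormal_frame_expand[OF F] ctr_def)
    also have "(\<Sum>f\<in>F'. (real_of_int (k f) * r / m) *\<^sub>R f) =
        (\<Sum>f\<in>F. (if f \<in> F' then real_of_int (k f) * r / m else 0) *\<^sub>R f)"
      using F(1) by (intro sum.mono_neutral_cong_left) (auto simp: F'_def)
    finally have "y - ctr k = (\<Sum>f\<in>F. c f *\<^sub>R f)"
      by (simp add: c_def scaleR_left_diff_distrib sum_subtractf)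
    moreover have "norm (\<Sum>f\<in>F. c f *\<^sub>R f) \<le> (\<Sum>f\<in>F. r / m)"
      by (rule sum_norm_le) (use c F(4) in simp)
    ultimately have "dist (ctr k) y \<le> real DIM('a) * r / m"
      using F(2) by (simp add: dist_norm norm_minus_commute)
    then show "y \<in> (\<Union>z\<in>ctr ` P. cball z (real DIM('a) * r / m))"
      using \<open>k \<in> P\<close> by (intro UN_I[of "ctr k"]) auto
  qed
  ultimately show ?thesis using that[of "ctr ` P"] finP by blast
qed

section \<open>Volume of sections and mass of the push-forward measure\<close>

lemma measure_strong_section_le:
  fixes v :: "'a::euclidean_space \<Rightarrow> real"
  assumes cvx: "convex_on B1 v" and "compact (strong_section v x p h)" "h > 0"
  shows "measure lebesgue (strong_section v x p h) \<le> measure lebesgue (section_set v (2 * h) p x)"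
proof (rule measure_mono_fmeasurable)
  \<comment> \<open>\<open>section_set\<close> is defined by a strict inequality; doubling the
    height absorbs the boundary of the closed section.\<close>
  show "strong_section v x p h \<subseteq> section_set v (2 * h) p x"
  proof
    fix y assume "y \<in> strong_section v x p h"
    then have "y \<in> B1" "v y - v x - p \<bullet> (y - x) + (norm (y - x))\<^sup>2 / 2 \<le> h"
      by (auto simp: strong_section_def paraboloid_gap_def)
    moreover have "0 \<le> (norm (y - x))\<^sup>2 / 2" by simp
    ultimately show "y \<in> section_set v (2 * h) p x"
      using \<open>h > 0\<close> unfolding section_set_def by (intro CollectI conjI) linarith+
  qed
  show "strong_section v x p h \<in> sets lebesgue"
    using assms(2) by (intro fmeasurableD lmeasurable_compact)
  have "section_set v (2 * h) p x = B1 \<inter> (\<lambda>y. v y - v x - p \<bullet> (y - x)) -` {..<2 * h}"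
    by (auto simp: section_set_def)
  moreover have "open (B1 \<inter> (\<lambda>y. v y - v x - p \<bullet> (y - x)) -` {..<2 * h})"
    using convex_on_continuous[OF open_ball cvx]
    by (intro continuous_open_preimage continuous_intros) auto
  moreover have "bounded (section_set v (2 * h) p x)"
    by (rule bounded_subset[OF bounded_ball[of 0 1]]) (auto simp: section_set_def)
  ultimately show "section_set v (2 * h) p x \<in> lmeasurable"
    by (metis lmeasurable_open)
qed

text \<open>The box with half-sides \<open>h / (2 * n * d f)\<close> lies in \<open>h / 2\<close>
  times the polar of the section about \<open>x\<close>: in the frame expansion of the inner product
  each of the \<open>n\<close> terms is at most \<open>h / (2 * n)\<close>. Translated by
  \<open>p + x\<close>, the box is covered by the image of the section under
  \<open>I + \<partial>v\<close>.\<close>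

lemma emeasure_resolvent_ge:
  fixes F :: "'a::euclidean_space set"
  assumes F: "finite F" "card F = DIM('a)" "pairwise orthogonal F" "\<And>f. f \<in> F \<Longrightarrow> norm f = 1"
    and d: "\<And>f. f \<in> F \<Longrightarrow> d f > 0" "\<And>f y. f \<in> F \<Longrightarrow> y \<in> strong_section v x p h \<Longrightarrow> \<bar>(y - x) \<bullet> f\<bar> \<le> d f"
    and cvx: "convex_on B1 v" and x: "x \<in> B1" and p: "subgradient_at v x p" and h: "h > 0"
    and sub: "cball x (sqrt (2 * h)) \<subseteq> cball 0 R" "R < 1"
    and M: "\<And>Q. (\<And>q. q \<in> Q \<Longrightarrow> \<exists>y\<in>strong_section v x p h \<inter> cball 0 R. subgradient_at v y (q - y)) \<Longrightarrow>
      emeasure lborel Q \<le> m"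
  shows "ennreal (\<Prod>f\<in>F. h / (real DIM('a) * d f)) \<le> m"
proof -
  let ?n = "real DIM('a)"
  define Q0 where "Q0 = {z. \<forall>f\<in>F. - (h / (2 * ?n * d f)) \<le> z \<bullet> f \<and> z \<bullet> f \<le> h / (2 * ?n * d f)}"
  have "emeasure lborel Q0 = ennreal (\<Prod>f\<in>F. h / (2 * ?n * d f) - (- (h / (2 * ?n * d f))))"
    unfolding Q0_def using F(2,3,4) d(1) h by (intro emeasure_lborel_orthonormal_box) (auto simp: less_imp_le)
  also have "(\<Prod>f\<in>F. h / (2 * ?n * d f) - (- (h / (2 * ?n * d f)))) = (\<Prod>f\<in>F. h / (?n * d f))"
    by (intro prod.cong) auto
  finally have eQ0: "emeasure lborel Q0 = ennreal (\<Prod>f\<in>F. h / (?n * d f))" .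
  have "0 < (\<Prod>f\<in>F. h / (?n * d f))" using d(1) h by (intro prod_pos) auto
  \<comment> \<open>Nonmeasurable sets have \<open>emeasure\<close> 0 by convention, so a nonzero
    value already implies measurability.\<close>
  then have Q0s: "Q0 \<in> sets borel" using eQ0 emeasure_neq_0_sets[of lborel Q0] by simp
  have subB: "cball x (sqrt (2 * h)) \<subseteq> B1" using sub by (auto simp: subset_eq)
  have "emeasure lborel ((\<lambda>q. q - (p + x)) -` Q0) \<le> m"
  proof (rule M)
    fix q assume "q \<in> (\<lambda>q. q - (p + x)) -` Q0"
    then have z: "\<bar>(q - (p + x)) \<bullet> f\<bar> \<le> h / (2 * ?n * d f)" if "f \<in> F" for f
      using that unfolding Q0_def vimage_def abs_le_iff by auto
    have half: "(q - (p + x)) \<bullet> (y - x) \<le> h / 2" if y: "y \<in> strong_section v x p h" for y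
    proof -
      have "(q - (p + x)) \<bullet> (y - x) = (q - (p + x)) \<bullet> (\<Sum>f\<in>F. ((y - x) \<bullet> f) *\<^sub>R f)"
        by (simp only: orthonormal_frame_expand[OF F])
      also have "\<dots> = (\<Sum>f\<in>F. ((y - x) \<bullet> f) * ((q - (p + x)) \<bullet> f))"
        by (simp add: inner_sum_right)
      also have "\<dots> \<le> (\<Sum>f\<in>F. h / (2 * ?n))"
      proof (rule sum_mono)
        fix f assume f: "f \<in> F"
        have "((y - x) \<bullet> f) * ((q - (p + x)) \<bullet> f) \<le> \<bar>(y - x) \<bullet> f\<bar> * \<bar>(q - (p + x)) \<bullet> f\<bar>"
          by (metis abs_ge_self abs_mult)
        also have "\<dots> \<le> d f * (h / (2 * ?n * d f))"
          using d(1)[OF f] d(2)[OF f y] z[OF f] by (intro mult_mono) auto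
        also have "\<dots> = h / (2 * ?n)" using d(1)[OF f] by simp
        finally show "((y - x) \<bullet> f) * ((q - (p + x)) \<bullet> f) \<le> h / (2 * ?n)" .
      qed
      also have "\<dots> = h / 2" using F(2) by simp
      finally show ?thesis .
    qed
    obtain y where y: "y \<in> strong_section v x p h" "subgradient_at v y (p + x + (q - (p + x)) - y)"
      by (rule subgradient_in_strong_section[OF cvx x p h subB half])
    moreover have "y \<in> cball 0 R"
      using strong_section_subset_cball[OF p, of h] h y(1) sub(1) by auto
    ultimately show "\<exists>y\<in>strong_section v x p h \<inter> cball 0 R. subgradient_at v y (q - y)" by auto
  qed
  then show ?thesis
    by (simp add: emeasure_lborel_translate_vimage[OF Q0s] eQ0)
qed

text \<open>If at most one factor lay below \<open>a\<close>, some \<open>card F - 1\<close> factors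
  would contribute at least \<open>a ^ (card F - 1)\<close> and the remaining one more than
  \<open>b\<close>, against the bound on the product.\<close>

lemma two_thin_directions:
  fixes d :: "'b \<Rightarrow> real"
  assumes F: "finite F" "F \<noteq> {}" "\<And>f. f \<in> F \<Longrightarrow> d f > 0" and "a > 0"
    and prod: "(\<Prod>f\<in>F. d f) \<le> b * a ^ (card F - 1)" and big: "\<And>f. f \<in> F \<Longrightarrow> d f > b"
  obtains f g where "f \<in> F" "g \<in> F" "f \<noteq> g" "d f < a" "d g < a"
proof -
  have "\<exists>f\<in>F. \<exists>g\<in>F. f \<noteq> g \<and> d f < a \<and> d g < a"
  proof (rule ccontr)
    assume contr: "\<not> ?thesis"
    have "\<exists>f\<in>F. \<forall>g\<in>F - {f}. a \<le> d g"
    proof (cases "\<exists>f\<in>F. d f < a")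
      case True
      then show ?thesis using contr by (metis Diff_iff insertI1 not_le)
    next
      case False
      then show ?thesis using F(2) by (auto simp: not_less)
    qed
    then obtain f where f: "f \<in> F" "\<And>g. g \<in> F - {f} \<Longrightarrow> a \<le> d g" by blast
    have "a ^ (card F - 1) = (\<Prod>g\<in>F - {f}. a)" using F(1) f(1) by simp
    also have "\<dots> \<le> (\<Prod>g\<in>F - {f}. d g)"
      using f(2) \<open>a > 0\<close> by (intro prod_mono) auto
    finally have "d f * a ^ (card F - 1) \<le> d f * (\<Prod>g\<in>F - {f}. d g)"
      using F(3)[OF f(1)] by (intro mult_left_mono) auto
    also have "\<dots> = (\<Prod>f\<in>F. d f)" using prod.remove[OF F(1) f(1), of d] by simp
    finally have "d f * a ^ (card F - 1) \<le> b * a ^ (card F - 1)" using prod by simp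
    then show False using big[OF f(1)] \<open>a > 0\<close> by simp
  qed
  then show ?thesis using that by blast
qed

text \<open>The order of quantifiers is the point: \<open>c\<close> depends only on the dimension
  and on \<open>C\<close>, whereas the thinness is arbitrary because a subgradient of maximal norm
  permits every slab constant \<open>L\<close>.\<close>

lemma Sigma_v_thin:
  fixes v :: "'a::euclidean_space \<Rightarrow> real"
  assumes cvx: "convex_on B1 v" and x: "x \<in> Sigma_v v" "norm x < R" and R: "R < 1"
    and M: "\<And>T Q. T \<in> sets borel \<Longrightarrow> (\<And>q. q \<in> Q \<Longrightarrow> \<exists>y\<in>T \<inter> cball 0 R. subgradient_at v y (q - y)) \<Longrightarrow>
        emeasure lborel Q \<le> emeasure M T"
  shows "\<exists>c>0. \<forall>\<eta>>0. \<forall>\<delta>>0.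
      \<exists>r K Z \<rho>. 0 < r \<and> r < \<delta> \<and> K \<in> sets borel \<and> K \<subseteq> cball x r \<and> finite Z \<and>
        K \<subseteq> (\<Union>z\<in>Z. cball z \<rho>) \<and> 0 < \<rho> \<and> \<rho> \<le> r \<and>
        real (card Z) * \<rho> ^ (DIM('a) - 1) \<le> \<eta> * r ^ (DIM('a) - 1) \<and>
        ennreal (c * r ^ (DIM('a) - 1)) \<le> emeasure M K"
proof -
  define n where "n = DIM('a)"
  have n: "n \<ge> 1" unfolding n_def by (simp add: Suc_leI)
  have xB: "x \<in> B1" using x(1) by (simp add: Sigma_v_def)
  obtain p where p: "subgradient_at v x p" "\<And>q. subgradient_at v x q \<Longrightarrow> norm q \<le> norm p"
    using max_norm_subgradient[OF cvx xB] by blast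
  then obtain C h0 where C: "C > 0" "h0 > 0" "\<And>h. 0 < h \<Longrightarrow> h < h0 \<Longrightarrow>
      measure lebesgue (section_set v h p x) < C * h powr ((real n + 1) / 2)"
    using x(1) unfolding Sigma_v_def n_def by blast
  \<comment> \<open>\<open>K\<close> joins the loss \<open>n^n\<close> of the box to the section
    constant \<open>C\<close>. The constant \<open>c\<close> below is what
    \<open>(h / n) ^ n / (K * r ^ (n + 1))\<close> leaves in front of \<open>r ^ (n - 1)\<close>
    when \<open>h = r\<^sup>2 / 2\<close>.\<close>
  define K where "K = real n ^ n * C"
  have K: "K > 0" using n C(1) by (simp add: K_def)
  define c where "c = 1 / (2 ^ n * real n ^ n * K)"
  have "c > 0" using n K by (simp add: c_def)
  have main: "\<exists>r T Z \<rho>. 0 < r \<and> r < \<delta> \<and> T \<in> sets borel \<and> T \<subseteq> cball x r \<and> finite Z \<and>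
        T \<subseteq> (\<Union>z\<in>Z. cball z \<rho>) \<and> 0 < \<rho> \<and> \<rho> \<le> r \<and>
        real (card Z) * \<rho> ^ (n - 1) \<le> \<eta> * r ^ (n - 1) \<and>
        ennreal (c * r ^ (n - 1)) \<le> emeasure M T" if "\<eta> > 0" "\<delta> > 0" for \<eta> \<delta>
  proof -
    \<comment> \<open>The cover will have content at most
      \<open>3 ^ (n - 2) * n ^ (n - 1) / m\<close> times \<open>r ^ (n - 1)\<close>, which has to
      stay below \<open>\<eta>\<close>; taking \<open>m \<ge> n\<close> makes the radius
      \<open>n * r / m\<close> at most \<open>r\<close>.\<close>
    obtain m0 :: nat where m0: "real m0 > 3 ^ n * real n ^ n / \<eta>" using reals_Archimedean2 by blast
    define m where "m = max m0 n"
    have m: "m > 0" "n \<le> m" "3 ^ n * real n ^ n \<le> \<eta> * m"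
    proof -
      have "3 ^ n * real n ^ n / \<eta> \<le> real m" using m0 by (simp add: m_def)
      then show "3 ^ n * real n ^ n \<le> \<eta> * m" using \<open>\<eta> > 0\<close> by (simp add: pos_divide_le_eq mult.commute)
    qed (use n in \<open>auto simp: m_def\<close>)
    \<comment> \<open>Calibrated so that \<open>K * r ^ (n + 1)\<close> equals
      \<open>L * h * (r / m) ^ (n - 1)\<close> when \<open>r\<^sup>2 = 2 * h\<close>, the form
      required by \<open>two_thin_directions\<close>.\<close>
    define L where "L = 2 * K * real m ^ (n - 1)"
    \<comment> \<open>The volume bound is used at height \<open>2 * h\<close>, hence
      \<open>h0 / 2\<close>; the other two terms give \<open>r < \<delta>\<close> and keep the ball
      about \<open>x\<close> inside \<open>cball 0 R\<close>.\<close>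
    define H where "H = min (h0 / 2) (min (\<delta>\<^sup>2 / 2) ((R - norm x)\<^sup>2 / 2))"
    have "L > 0" using K m(1) by (simp add: L_def)
    moreover have "H > 0" using C(2) \<open>\<delta> > 0\<close> x(2) by (simp add: H_def)
    ultimately obtain h where h: "0 < h" "h < H" and
      slab: "\<And>e. norm e = 1 \<Longrightarrow> \<exists>y\<in>strong_section v x p h. \<bar>(y - x) \<bullet> e\<bar> > L * h"
      using strong_section_not_in_slab[OF cvx xB p] by blast
    define r where "r = sqrt (2 * h)"
    define T where "T = strong_section v x p h"
    have r: "r > 0" "r\<^sup>2 = 2 * h" using h(1) by (simp_all add: r_def)
    have "r < \<delta>"
      using h(2) \<open>\<delta> > 0\<close> r by (intro power2_less_imp_less[of r \<delta>]) (auto simp: H_def)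
    have "r < R - norm x"
      using h(2) x(2) r by (intro power2_less_imp_less[of r]) (auto simp: H_def)
    have sub: "cball x r \<subseteq> cball 0 R"
    proof
      fix y assume "y \<in> cball x r"
      then have "norm (y - x) \<le> r" by (simp add: dist_norm norm_minus_commute)
      then show "y \<in> cball 0 R" using norm_triangle_sub[of y x] \<open>r < R - norm x\<close> by simp
    qed
    have subB: "cball x r \<subseteq> B1" using sub R by (auto simp: subset_eq)
    have Tr: "T \<subseteq> cball x r" unfolding T_def r_def using strong_section_subset_cball[OF p(1)] h(1) by simp
    have "compact T" unfolding T_def
      using compact_strong_section[OF cvx p(1)] subB h(1) by (simp add: r_def)
    then have Ts: "T \<in> sets borel" by (rule borel_compact)
    have "measure lebesgue T \<le> measure lebesgue (section_set v (2 * h) p x)"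
      unfolding T_def using \<open>compact T\<close> h(1) by (intro measure_strong_section_le[OF cvx]) (auto simp: T_def)
    also have "\<dots> \<le> C * (2 * h) powr ((real n + 1) / 2)"
      using C(3)[of "2 * h"] h by (simp add: H_def)
    also have "(2 * h) powr ((real n + 1) / 2) = r ^ (n + 1)"
    proof -
      have "(2 * h) powr ((real n + 1) / 2) = (r powr 2) powr ((real n + 1) / 2)"
        using r by (simp add: powr_numeral)
      also have "\<dots> = r powr real (n + 1)" by (simp add: powr_powr add_divide_distrib add.commute)
      also have "\<dots> = r ^ (n + 1)" using r(1) by (rule powr_realpow)
      finally show ?thesis .
    qed
    finally have measT: "measure lebesgue T \<le> C * r ^ (n + 1)" .
    define T' where "T' = (+) (- x) ` T"
    have "compact T'" unfolding T'_def using \<open>compact T\<close> by (rule compact_translation)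
    moreover have "convex T'" unfolding T'_def T_def by (intro convex_translation convex_strong_section[OF cvx])
    moreover have "0 \<in> interior T'"
    proof -
      obtain e where "e > 0" "ball x e \<subseteq> T"
        using strong_section_neighbourhood[OF cvx xB, of x p h] h(1) unfolding T_def by auto
      then have "x \<in> interior T" using interior_maximal[OF _ open_ball, of x e T] by auto
      then show ?thesis unfolding T'_def interior_translation by (auto intro!: image_eqI[of _ _ x])
    qed
    ultimately have body: "compact T'" "0 \<in> interior T'" "convex T'" by blast+
    obtain F d where F: "finite F" "card F = n" "pairwise orthogonal F"
      "\<And>f. f \<in> F \<Longrightarrow> norm f = 1" and d: "\<And>f. f \<in> F \<Longrightarrow> d f > 0"
      "\<And>f y. f \<in> F \<Longrightarrow> y \<in> T' \<Longrightarrow> \<bar>y \<bullet> f\<bar> \<le> d f"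
      and prod: "(\<Prod>f\<in>F. d f) \<le> real n ^ n * measure lebesgue T'"
      by (rule convex_body_orthonormal_box[OF body, folded n_def]) (rule that)
    have dT: "\<bar>(y - x) \<bullet> f\<bar> \<le> d f" if "f \<in> F" "y \<in> T" for f y
      using d(2)[OF that(1), of "y - x"] that(2) by (simp add: T'_def image_iff)
    have prodK: "(\<Prod>f\<in>F. d f) \<le> K * r ^ (n + 1)"
    proof -
      have "(\<Prod>f\<in>F. d f) \<le> real n ^ n * measure lebesgue T"
        using prod unfolding T'_def measure_translation .
      also have "\<dots> \<le> real n ^ n * (C * r ^ (n + 1))" using measT by (intro mult_left_mono) auto
      finally show ?thesis by (simp add: K_def mult.assoc)
    qed
    have prod_thin: "(\<Prod>f\<in>F. d f) \<le> L * h * (r / m) ^ (card F - 1)"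
    proof -
      have "r ^ (n + 1) = r ^ (2 + (n - 1))" using n by simp
      then have "r ^ (n + 1) = 2 * h * r ^ (n - 1)" using r(2) by (simp only: power_add)
      then have "K * r ^ (n + 1) = L * h * (r / m) ^ (n - 1)"
        using m(1) by (simp add: L_def power_divide)
      then show ?thesis using prodK F(2) by simp
    qed
    have big: "L * h < d f" if f: "f \<in> F" for f
    proof -
      obtain y where "y \<in> T" "\<bar>(y - x) \<bullet> f\<bar> > L * h" using slab[OF F(4)[OF f]] unfolding T_def by blast
      then show ?thesis using dT[OF f, of y] by simp
    qed
    have "F \<noteq> {}" using F(2) n by auto
    have "r / m > 0" using r(1) m(1) by simp
    obtain f g where fg: "f \<in> F" "g \<in> F" "f \<noteq> g" "d f < r / m" "d g < r / m"
      by (rule two_thin_directions[OF F(1) \<open>F \<noteq> {}\<close> d(1) \<open>r / m > 0\<close> prod_thin big])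
    \<comment> \<open>The exponent \<open>n - 2\<close> needs \<open>n \<ge> 2\<close>, which comes
      for free: in dimension 1, \<open>prod_thin\<close> and \<open>big\<close> contradict each
      other.\<close>
    have "card {f, g} \<le> card F" using fg F(1) by (intro card_mono) auto
    then have n2: "n \<ge> 2" using F(2) fg(3) by simp
    have dr: "\<bar>(y - x) \<bullet> f'\<bar> \<le> r" if "y \<in> T" "f' \<in> F" for y f'
    proof -
      have "norm (y - x) \<le> r" using Tr that(1) by (auto simp: dist_norm norm_minus_commute)
      then show ?thesis using Cauchy_Schwarz_ineq2[of "y - x" f'] F(4)[OF that(2)] by simp
    qed
    have df: "\<bar>(y - x) \<bullet> f\<bar> \<le> r / m" and dg: "\<bar>(y - x) \<bullet> g\<bar> \<le> r / m" if "y \<in> T" for y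
      using dT[OF fg(1) that] dT[OF fg(2) that] fg(4,5) by auto
    obtain Z where Z: "finite Z" "card Z \<le> (2 * m + 1) ^ (n - 2)" "T \<subseteq> (\<Union>z\<in>Z. cball z (real n * r / m))"
      by (rule thin_box_cover[OF F(1) F(2)[unfolded n_def] F(3,4) fg(1-3) r(1) m(1) dr df dg, where T=T, folded n_def])
        (assumption | rule that)+
    have \<rho>: "0 < real n * r / m" "real n * r / m \<le> r"
      using n m r(1) by (auto simp: field_simps)
    have cardZ: "real (card Z) * (real n * r / m) ^ (n - 1) \<le> \<eta> * r ^ (n - 1)"
    proof -
      have "real (card Z) \<le> real ((2 * m + 1) ^ (n - 2))" using Z(2) by (simp only: of_nat_le_iff)
      also have "\<dots> = (2 * real m + 1) ^ (n - 2)" by (simp add: add.commute)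
      also have "\<dots> \<le> (3 * real m) ^ (n - 2)" using m(1) by (intro power_mono) auto
      finally have "real (card Z) * (real n * r / m) ^ (n - 1) \<le> (3 * real m) ^ (n - 2) * (real n * r / m) ^ (n - 1)"
        using r(1) by (intro mult_right_mono) auto
      also have "\<dots> = 3 ^ (n - 2) * real n ^ (n - 1) * (real m ^ (n - 2) / real m ^ (n - 1)) * r ^ (n - 1)"
        by (simp add: power_mult_distrib power_divide)
      also have "real m ^ (n - 2) / real m ^ (n - 1) = 1 / m"
      proof -
        have "n - 1 = Suc (n - 2)" using n2 by simp
        then show ?thesis using m(1) by simp
      qed
      also have "3 ^ (n - 2) * real n ^ (n - 1) * (1 / m) \<le> \<eta>"
      proof -
        have "(3::real) ^ (n - 2) * real n ^ (n - 1) \<le> 3 ^ n * real n ^ n"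
          using n by (intro mult_mono power_increasing) auto
        then show ?thesis using m(1,3) by (simp add: pos_divide_le_eq)
      qed
      finally show ?thesis using r(1) by (simp add: mult_right_mono)
    qed
    have "ennreal (\<Prod>f\<in>F. h / (real DIM('a) * d f)) \<le> emeasure M T"
    proof (rule emeasure_resolvent_ge[OF F(1) F(2)[unfolded n_def] F(3,4) d(1) _ cvx xB p(1) h(1) _ R])
      show "\<bar>(y - x) \<bullet> f\<bar> \<le> d f" if "f \<in> F" "y \<in> strong_section v x p h" for f y
        using dT that by (simp add: T_def)
      show "cball x (sqrt (2 * h)) \<subseteq> cball 0 R" using sub by (simp add: r_def)
      show "emeasure lborel Q \<le> emeasure M T"
        if "\<And>q. q \<in> Q \<Longrightarrow> \<exists>y\<in>strong_section v x p h \<inter> cball 0 R. subgradient_at v y (q - y)" for Q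
        using M[OF Ts] that unfolding T_def by blast
    qed
    moreover have "c * r ^ (n - 1) \<le> (\<Prod>f\<in>F. h / (real DIM('a) * d f))"
    proof -
      have pos: "0 < (\<Prod>f\<in>F. d f)" using d(1) by (intro prod_pos)
      \<comment> \<open>This is why volume of order \<open>r ^ (n + 1)\<close> forces mass of order
        \<open>r ^ (n - 1)\<close>: the mass is at least of order \<open>(r\<^sup>2) ^ n\<close>
        divided by the volume bound.\<close>
      have "(n - 1) + (n + 1) = 2 * n" using n by simp
      then have "r ^ (n - 1) * r ^ (n + 1) = (r\<^sup>2) ^ n"
        by (simp only: power_add[symmetric] power_mult[symmetric])
      then have "c * r ^ (n - 1) * (K * r ^ (n + 1)) = (2 * h) ^ n / (2 ^ n * real n ^ n)"
        using K unfolding r(2) by (simp add: c_def)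
      also have "\<dots> = (h / n) ^ n" by (simp add: power_mult_distrib power_divide)
      finally have eq: "c * r ^ (n - 1) * (K * r ^ (n + 1)) = (h / n) ^ n" .
      have "c * r ^ (n - 1) * (\<Prod>f\<in>F. d f) \<le> (h / n) ^ n"
        unfolding eq[symmetric] using prodK \<open>c > 0\<close> r(1) by (intro mult_left_mono) auto
      then have "c * r ^ (n - 1) \<le> (h / n) ^ n / (\<Prod>f\<in>F. d f)"
        using pos by (simp add: pos_le_divide_eq)
      also have "\<dots> = (\<Prod>f\<in>F. h / n / d f)"
        by (simp only: prod_dividef prod_constant F(2) power_divide)
      finally show ?thesis by (simp add: n_def)
    qed
    ultimately have "ennreal (c * r ^ (n - 1)) \<le> emeasure M T"
      using ennreal_leI order_trans by blast
    then show ?thesis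
      using r(1) \<open>r < \<delta>\<close> Ts Tr Z(1,3) \<rho> cardZ by (intro exI conjI)
  qed
  then show ?thesis using \<open>c > 0\<close> unfolding n_def by blast
qed

theorem theorem3p1:
  fixes v :: "'a::euclidean_space \<Rightarrow> real"
  assumes "convex_on B1 v"
  shows "hausdorff_measure (DIM('a) - 1) (Sigma_v v) = 0"
proof -
  \<comment> \<open>Subgradients are bounded, and the finite measure is available, only on balls of
    radius below 1; countably many of these exhaust \<open>B1\<close>.\<close>
  define R where "R k = 1 - 1 / real (k + 2)" for k :: nat
  have R: "R k < 1" for k by (simp add: R_def)
  have "hausdorff_measure (DIM('a) - 1) {x \<in> Sigma_v v. norm x < R k} = 0" for k
  proof -
    obtain M :: "'a measure" where M: "sets M = sets borel" "emeasure M (space M) \<noteq> \<infinity>"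
      "\<And>T Q. T \<in> sets borel \<Longrightarrow> (\<And>q. q \<in> Q \<Longrightarrow> \<exists>y\<in>T \<inter> cball 0 (R k). subgradient_at v y (q - y)) \<Longrightarrow>
        emeasure lborel Q \<le> emeasure M T"
      using resolvent_measure[OF assms R] by blast
    show ?thesis
    proof (rule hausdorff_measure_null_thin[OF M(1,2)])
      fix x assume "x \<in> {x \<in> Sigma_v v. norm x < R k}"
      then have x: "x \<in> Sigma_v v" "norm x < R k" by auto
      show "\<exists>c>0. \<forall>\<eta>>0. \<forall>\<delta>>0.
        \<exists>r K Z \<rho>. 0 < r \<and> r < \<delta> \<and> K \<in> sets borel \<and> K \<subseteq> cball x r \<and> finite Z \<and>
          K \<subseteq> (\<Union>z\<in>Z. cball z \<rho>) \<and> 0 < \<rho> \<and> \<rho> \<le> r \<and>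
          real (card Z) * \<rho> ^ (DIM('a) - 1) \<le> \<eta> * r ^ (DIM('a) - 1) \<and>
          ennreal (c * r ^ (DIM('a) - 1)) \<le> emeasure M K"
        by (rule Sigma_v_thin[OF assms x R M(3)])
    qed
  qed
  then have "hausdorff_measure (DIM('a) - 1) (\<Union>k. {x \<in> Sigma_v v. norm x < R k}) = 0"
    by (rule hausdorff_measure_UN_null)
  moreover have "Sigma_v v \<subseteq> (\<Union>k. {x \<in> Sigma_v v. norm x < R k})"
  proof
    fix x assume x: "x \<in> Sigma_v v"
    then have "1 - norm x > 0" by (simp add: Sigma_v_def)
    then obtain k :: nat where "1 / Suc k < 1 - norm x" using nat_approx_posE by blast
    moreover have "1 / real (k + 2) \<le> 1 / Suc k" by (simp add: field_simps)
    ultimately have "norm x < R k" by (simp add: R_def)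
    then show "x \<in> (\<Union>k. {x \<in> Sigma_v v. norm x < R k})" using x by blast
  qed
  ultimately show ?thesis by (rule hausdorff_measure_null_subset)
qed

end
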